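(* For $n\ge4$, the maps $\Phi_\pi:K_\pi\to\Delta_\pi\subset\mathfrak S_n$ (one for each circular ordering $\pi$) are compatible with the identifications defining $\overline{\mathcal M}_{0,n}(\mathbb R)$, and together they define an embedding of $\overline{\mathcal M}_{0,n}(\mathbb R)$ into the network space $\mathfrak S_n$.
   Context: $X$ is a set of $n\ge4$ labels. A split of $X$ is an unordered partition into two nonempty sets, trivial if one part is a singleton. A circular ordering is a cyclic arrangement $\pi=(x_1,\dots,x_n)$ of $X$ up to rotation and reflection; a split is circular w.r.t. $\pi$ if of the form $\{\{x_{i+1},\dots,x_j\},X\setminus\{x_{i+1},\dots,x_j\}\}$. With $\delta=2^{n-1}-n-1$ and $\mathbb R^\delta$ having coordinates indexed by nontrivial splits, the chamber $\Delta_\pi$ is the set of nonnegative vectors with coordinate sum 1 supported on splits circular w.r.t. $\pi$, and the network space is $\mathfrak S_n=\bigcup_\pi\Delta_\pi$. For each $\pi$, let $P_\pi$ be the regular $n$-gon with edges labeled cyclically by $\pi$; its diagonals correspond to nontrivial splits circular w.r.t. $\pi$. Let $K_\pi$ be a copy of the associahedron $K_{n-1}$: the $(n-3)$-dimensional polytope whose faces correspond to sets $D$ of pairwise noncrossing diagonals of $P_\pi$ (face of $D$ contains face of $D'$ iff $D\subseteq D'$; vertices = triangulations). The map $\Phi_\pi:K_\pi\to\Delta_\pi$ is defined as follows: for a triangulation $T$, $\Phi_\pi(T)$ has coordinate $1/(n-3)$ at each split in $T$ and $0$ elsewhere; for a face with diagonal set $D$, the barycenter is sent to $\Phi_\pi(D)$,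 the average of $\Phi_\pi(T)$ over triangulations $T\supseteq D$; and $\Phi_\pi$ is extended affinely over each simplex of the barycentric subdivision of $K_\pi$ (simplices = convex hulls of barycenters of chains of faces). The compactified real moduli space $\overline{\mathcal M}_{0,n}(\mathbb R)$ of stable genus-zero real curves with $n$ marked points is (by a known result) obtained from the disjoint union of the $(n-1)!/2$ polytopes $K_\pi$ by identifying the face of $K_\pi$ given by a labeled polygon with noncrossing diagonals $(P_\pi,D)$ with the face of $K_{\pi'}$ given by $(P_{\pi'},D')$ whenever $(P_{\pi'},D')$ is obtained from $(P_\pi,D)$ by twisting along diagonals of $D$ (a twist along a diagonal cuts the labeled polygon along it, reflects one piece, and reglues, i.e. reverses the block of labels on one side; diagonals are carried along and represent the same splits). *)

theory Defs
  imports "HOL-Analysis.Analysis"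
begin

definition is_split :: "nat \<Rightarrow> nat set set \<Rightarrow> bool" where
  "is_split n S \<longleftrightarrow> (\<exists>A. S = {A, {0..<n} - A} \<and> A \<noteq> {} \<and> A \<subset> {0..<n})"

definition nontrivial_split :: "nat \<Rightarrow> nat set set \<Rightarrow> bool" where
  "nontrivial_split n S \<longleftrightarrow> is_split n S \<and> (\<forall>A\<in>S. 2 \<le> card A)"

definition lin_ord :: "nat \<Rightarrow> nat list \<Rightarrow> bool" where
  "lin_ord n ys \<longleftrightarrow> distinct ys \<and> set ys = {0..<n}"

definition circ_ord :: "nat \<Rightarrow> nat list \<Rightarrow> nat list set" where
  "circ_ord n ys = {zs. lin_ord n zs \<and> (\<exists>k. zs = rotate k ys \<or> zs = rotate k (rev ys))}"

definition circ_orderings :: "nat \<Rightarrow> nat list set set" where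
  "circ_orderings n = circ_ord n ` {ys. lin_ord n ys}"

definition circular_split :: "nat \<Rightarrow> nat list set \<Rightarrow> nat set set \<Rightarrow> bool" where
  "circular_split n \<pi> S \<longleftrightarrow>
     (\<exists>ys\<in>\<pi>. \<exists>k. 0 < k \<and> k < n \<and> S = {set (take k ys), set (drop k ys)})"

text \<open>Chambers and network space; R^delta = functions on splits vanishing off nontrivial splits.\<close>

definition chamber :: "nat \<Rightarrow> nat list set \<Rightarrow> (nat set set \<Rightarrow> real) set" where
  "chamber n \<pi> = {x. (\<forall>S. 0 \<le> x S) \<and>
      (\<forall>S. x S \<noteq> 0 \<longrightarrow> nontrivial_split n S \<and> circular_split n \<pi> S) \<and>
      sum x {S. nontrivial_split n S} = 1}"

definition network_space :: "nat \<Rightarrow> (nat set set \<Rightarrow> real) set" where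
  "network_space n = (\<Union>\<pi>\<in>circ_orderings n. chamber n \<pi>)"

text \<open>The polygon P_pi for a representative list ys: vertices 0..n-1, edge i (labelled ys!i)
  joins vertex i and vertex i+1 mod n. The diagonal from vertex i to vertex j (i<j) cuts off
  the edges i..j-1.\<close>

definition is_diag :: "nat \<Rightarrow> nat \<Rightarrow> nat \<Rightarrow> bool" where
  "is_diag n i j \<longleftrightarrow> i < j \<and> j < n \<and> 2 \<le> j - i \<and> j - i + 2 \<le> n"

definition diag_split :: "nat list \<Rightarrow> nat \<Rightarrow> nat \<Rightarrow> nat set set" where
  "diag_split ys i j = {set (take (j - i) (drop i ys)), set ys - set (take (j - i) (drop i ys))}"

definition crosses :: "nat \<Rightarrow> nat \<Rightarrow> nat \<Rightarrow> nat \<Rightarrow> bool" where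
  "crosses i j k l \<longleftrightarrow> (i < k \<and> k < j \<and> j < l) \<or> (k < i \<and> i < l \<and> l < j)"

text \<open>Sets of pairwise noncrossing diagonals of P_pi (= faces of K_pi), and triangulations.\<close>

definition noncrossing :: "nat \<Rightarrow> nat list set \<Rightarrow> nat set set set \<Rightarrow> bool" where
  "noncrossing n \<pi> D \<longleftrightarrow> (\<forall>ys\<in>\<pi>.
      D \<subseteq> {diag_split ys i j | i j. is_diag n i j} \<and>
      (\<forall>i j k l. is_diag n i j \<and> is_diag n k l \<and> diag_split ys i j \<in> D \<and> diag_split ys k l \<in> D
          \<longrightarrow> \<not> crosses i j k l))"

definition triangulation :: "nat \<Rightarrow> nat list set \<Rightarrow> nat set set set \<Rightarrow> bool" where
  "triangulation n \<pi> T \<longleftrightarrow> noncrossing n \<pi> T \<and> (\<forall>T'. noncrossing n \<pi> T' \<and> T \<subseteq> T' \<longrightarrow> T' = T)"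

definition Phi_tri :: "nat \<Rightarrow> nat set set set \<Rightarrow> nat set set \<Rightarrow> real" where
  "Phi_tri n T = (\<lambda>S. if S \<in> T then 1 / (real n - 3) else 0)"

definition Phi_face :: "nat \<Rightarrow> nat list set \<Rightarrow> nat set set set \<Rightarrow> nat set set \<Rightarrow> real" where
  "Phi_face n \<pi> D = (\<lambda>S. (\<Sum>T\<in>{T. triangulation n \<pi> T \<and> D \<subseteq> T}. Phi_tri n T S)
                         / real (card {T. triangulation n \<pi> T \<and> D \<subseteq> T}))"

text \<open>K_pi modelled by its barycentric subdivision: a point is a convex combination of the
  barycenters of a chain of faces, i.e. a weight function on faces (noncrossing diagonal sets)
  that is nonnegative, sums to 1 and whose support is a chain.\<close>

definition K_point :: "nat \<Rightarrow> nat list set \<Rightarrow> (nat set set set \<Rightarrow> real) \<Rightarrow> bool" where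
  "K_point n \<pi> w \<longleftrightarrow> (\<forall>D. 0 \<le> w D) \<and> (\<forall>D. w D \<noteq> 0 \<longrightarrow> noncrossing n \<pi> D) \<and>
     sum w {D. noncrossing n \<pi> D} = 1 \<and>
     (\<forall>D E. w D \<noteq> 0 \<and> w E \<noteq> 0 \<longrightarrow> D \<subseteq> E \<or> E \<subseteq> D)"

definition Phi_pt :: "nat \<Rightarrow> nat list set \<Rightarrow> (nat set set set \<Rightarrow> real) \<Rightarrow> nat set set \<Rightarrow> real" where
  "Phi_pt n \<pi> w = (\<lambda>S. \<Sum>D\<in>{D. noncrossing n \<pi> D}. w D * Phi_face n \<pi> D S)"

definition Kspace :: "nat \<Rightarrow> (nat list set \<times> (nat set set set \<Rightarrow> real)) set" where
  "Kspace n = {(\<pi>, w). \<pi> \<in> circ_orderings n \<and> K_point n \<pi> w}"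

definition Ktop :: "nat \<Rightarrow> (nat list set \<times> (nat set set set \<Rightarrow> real)) topology" where
  "Ktop n = subtopology (prod_topology (discrete_topology (circ_orderings n)) (powertop_real UNIV)) (Kspace n)"

definition Phi :: "nat \<Rightarrow> nat list set \<times> (nat set set set \<Rightarrow> real) \<Rightarrow> nat set set \<Rightarrow> real" where
  "Phi n p = Phi_pt n (fst p) (snd p)"

definition twist_step :: "nat \<Rightarrow> nat list set \<Rightarrow> nat set set \<Rightarrow> nat list set \<Rightarrow> bool" where
  "twist_step n \<pi> d \<pi>' \<longleftrightarrow> (\<exists>ys\<in>\<pi>. \<exists>k. 0 < k \<and> k < n \<and> d = {set (take k ys), set (drop k ys)} \<and>
       \<pi>' = circ_ord n (rev (take k ys) @ drop k ys))"

definition twists :: "nat \<Rightarrow> nat set set set \<Rightarrow> nat list set \<Rightarrow> nat list set \<Rightarrow> bool" where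
  "twists n D = (\<lambda>a b. \<exists>d\<in>D. twist_step n a d b)\<^sup>*\<^sup>*"

text \<open>Generating identifications: a point of the face D of K_pi (support on faces containing D)
  is identified with the same point of the face D of K_pi', pi' obtained by twisting along D.\<close>

definition ident :: "nat \<Rightarrow> nat list set \<times> (nat set set set \<Rightarrow> real) \<Rightarrow>
                     nat list set \<times> (nat set set set \<Rightarrow> real) \<Rightarrow> bool" where
  "ident n p q \<longleftrightarrow> p \<in> Kspace n \<and> q \<in> Kspace n \<and> snd p = snd q \<and>
     (\<exists>D. noncrossing n (fst p) D \<and> twists n D (fst p) (fst q) \<and>
          (\<forall>E. snd p E \<noteq> 0 \<longrightarrow> D \<subseteq> E))"

end

theory Submission
  imports Defs
begin

text \<open>
  Two diagonals of a polygon are noncrossing iff their splits have disjoint parts, a condition that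
  does not mention the ordering; a twist along \<open>d\<close> preserves circularity of every split compatible
  with \<open>d\<close>, so the triangulations containing a face agree in all orderings glued along that face, and
  \<open>\<Phi>\<close> respects the gluing.

  For injectivity, scale \<open>\<Phi>(D)\<close> by \<open>n - 3\<close>. Its value at \<open>S\<close> is 1 exactly for \<open>S \<in> D\<close>: a diagonal
  outside \<open>D\<close> is missed by some triangulation containing \<open>D\<close>, by a flip. It is positive exactly when
  \<open>S\<close> can be added to \<open>D\<close>. Hence the image of a point whose support is a chain with least face \<open>D\<close>
  determines \<open>D\<close> (the coordinates equal to 1) and the splits circular and compatible with \<open>D\<close> (the
  support). The latter determine the ordering up to twists along \<open>D\<close>: after cutting at a root label,
  each block of \<open>D\<close> carries one orientation relative to a reference ordering, and the orientations are
  corrected by twists from the outermost block inwards. Within one ordering, the weights are recovered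
  by repeatedly subtracting the weight of the least face. Compactness turns the continuous injection
  into an embedding.
\<close>

section \<open>Circular orderings and noncrossing splits\<close>


definition diags :: "nat \<Rightarrow> nat list \<Rightarrow> nat set set set" where
  "diags n ys = {diag_split ys i j | i j. is_diag n i j}"

definition compat :: "nat set set \<Rightarrow> nat set set \<Rightarrow> bool" where
  "compat S S' \<longleftrightarrow> (\<exists>A\<in>S. \<exists>B\<in>S'. A \<inter> B = {})"

lemma lin_ord_length: "lin_ord n ys \<Longrightarrow> length ys = n"
  unfolding lin_ord_def using distinct_card by fastforce

lemma lin_ord_inj: "lin_ord n ys \<Longrightarrow> inj_on ((!) ys) {0..<n}"
  using lin_ord_length[of n ys] by (auto simp: lin_ord_def inj_on_nth)

lemma lin_ord_nth_eq_iff: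
  "lin_ord n ys \<Longrightarrow> p < n \<Longrightarrow> q < n \<Longrightarrow> ys ! p = ys ! q \<longleftrightarrow> p = q"
  using lin_ord_length[of n ys] by (auto simp: lin_ord_def nth_eq_iff_index_eq)

lemma lin_ord_nth_less: "lin_ord n ys \<Longrightarrow> p < n \<Longrightarrow> ys ! p < n"
  using lin_ord_length[of n ys] nth_mem[of p ys] by (auto simp: lin_ord_def)

lemma lin_ord_image: "lin_ord n ys \<Longrightarrow> (!) ys ` {0..<n} = {0..<n}"
  using lin_ord_length[of n ys] by (auto simp: lin_ord_def nth_image)

lemma lin_ord_nth_mem_image_iff:
  "lin_ord n ys \<Longrightarrow> p < n \<Longrightarrow> j \<le> n \<Longrightarrow> ys ! p \<in> (!) ys ` {i..<j} \<longleftrightarrow> i \<le> p \<and> p < j"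
  by (auto simp: lin_ord_nth_eq_iff)

lemma set_take_drop_eq_image:
  assumes "j \<le> length ys"
  shows "set (take (j - i) (drop i ys)) = (!) ys ` {i..<j}"
proof (cases "i \<le> j")
  case True
  have "set (take (j - i) (drop i ys)) = (!) (drop i ys) ` {0..<j - i}"
    using assms nth_image[of "j - i" "drop i ys"] by (simp del: nth_drop add: atLeast0LessThan)
  also have "\<dots> = (!) ys ` ((+) i ` {0..<j - i})"
    unfolding image_image using assms True by (intro image_cong) auto
  also have "(+) i ` {0..<j - i} = {i..<j}"
    using True by (simp add: image_add_atLeastLessThan)
  finally show ?thesis .
qed auto

lemma diag_split_eq:
  assumes "lin_ord n ys" "j \<le> n"
  shows "diag_split ys i j = {(!) ys ` {i..<j}, {0..<n} - (!) ys ` {i..<j}}"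
  using assms set_take_drop_eq_image[of j ys i] lin_ord_length[of n ys]
  unfolding diag_split_def by (simp add: lin_ord_def)

lemma lin_ord_compl_prefix:
  assumes "lin_ord n ys" "j \<le> n"
  shows "{0..<n} - (!) ys ` {0..<j} = (!) ys ` {j..<n}"
proof -
  have "(!) ys ` ({0..<n} - {0..<j}) = (!) ys ` {0..<n} - (!) ys ` {0..<j}"
    using assms by (intro inj_on_image_set_diff[OF lin_ord_inj[of n]]) auto
  moreover have "{0..<n} - {0..<j} = {j..<n}" using assms by auto
  ultimately show ?thesis using lin_ord_image[OF assms(1)] by simp
qed

lemma lin_ord_image_subset: "lin_ord n ys \<Longrightarrow> j \<le> n \<Longrightarrow> (!) ys ` {i..<j} \<subseteq> {0..<n}"
  using lin_ord_nth_less by fastforce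

lemma diagsI:
  assumes "lin_ord n ys" "is_diag n i j" "A = (!) ys ` {i..<j}"
  shows "{A, {0..<n} - A} \<in> diags n ys"
  unfolding diags_def using assms diag_split_eq[of n ys j i] by (fastforce simp: is_diag_def)

lemma diagsI2:
  assumes "lin_ord n ys" "is_diag n i j" "{0..<n} - A = (!) ys ` {i..<j}" "A \<subseteq> {0..<n}"
  shows "{A, {0..<n} - A} \<in> diags n ys"
proof -
  have "{0..<n} - ({0..<n} - A) = A" using assms(4) by blast
  then have "{A, {0..<n} - A} = {{0..<n} - A, {0..<n} - ({0..<n} - A)}" by (metis insert_commute)
  then show ?thesis using diagsI[OF assms(1-3)] by simp
qed

lemma diagsE:
  assumes "S \<in> diags n ys" "lin_ord n ys"
  obtains i j where "is_diag n i j" "S = diag_split ys i j"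
    "S = {(!) ys ` {i..<j}, {0..<n} - (!) ys ` {i..<j}}"
proof -
  obtain i j where ij: "is_diag n i j" "S = diag_split ys i j"
    using assms unfolding diags_def by blast
  then have "S = {(!) ys ` {i..<j}, {0..<n} - (!) ys ` {i..<j}}"
    using diag_split_eq[OF assms(2), of j i] by (simp add: is_diag_def)
  with ij show thesis using that by blast
qed

lemma finite_diags: "finite (diags n ys)"
proof -
  have "diags n ys \<subseteq> (\<lambda>(i, j). diag_split ys i j) ` ({..<n} \<times> {..<n})"
    unfolding diags_def is_diag_def by force
  then show ?thesis by (rule finite_subset) auto
qed

lemma lin_ord_rotate: "lin_ord n (rotate k ys) = lin_ord n ys"
  by (simp add: lin_ord_def)

lemma lin_ord_rev: "lin_ord n (rev ys) = lin_ord n ys"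
  by (simp add: lin_ord_def)

lemma diags_rotate1_subset:
  assumes ys: "lin_ord n ys"
  shows "diags n ys \<subseteq> diags n (rotate1 ys)"
proof
  fix S assume "S \<in> diags n ys"
  then obtain i j where ij: "is_diag n i j" and S: "S = {(!) ys ` {i..<j}, {0..<n} - (!) ys ` {i..<j}}"
    using ys by (rule diagsE)
  have zs: "lin_ord n (rotate1 ys)" using lin_ord_rotate[of n 1 ys] ys by simp
  have nth: "rotate1 ys ! p = ys ! Suc p" if "Suc p < n" for p
    using that lin_ord_length[OF ys] by (simp add: nth_rotate1)
  have shift: "(!) (rotate1 ys) ` {a - 1..<b - 1} = (!) ys ` {a..<b}" if "1 \<le> a" "b \<le> n" for a b
  proof -
    have "(!) (rotate1 ys) ` {a - 1..<b - 1} = (\<lambda>p. ys ! Suc p) ` {a - 1..<b - 1}"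
      using that by (intro image_cong) (auto simp: nth)
    also have "\<dots> = (!) ys ` (Suc ` {a - 1..<b - 1})" by (simp only: image_image)
    also have "Suc ` {a - 1..<b - 1} = {a..<b}" using that by (cases b) auto
    finally show ?thesis .
  qed
  show "S \<in> diags n (rotate1 ys)"
  proof (cases "i = 0")
    case False
    then have "is_diag n (i - 1) (j - 1)" "(!) ys ` {i..<j} = (!) (rotate1 ys) ` {i - 1..<j - 1}"
      using ij shift[of i j] by (auto simp: is_diag_def)
    then show ?thesis unfolding S by (intro diagsI[OF zs])
  next
    case True
    then have "is_diag n (j - 1) (n - 1)" "{0..<n} - (!) ys ` {i..<j} = (!) (rotate1 ys) ` {j - 1..<n - 1}"
      using ij shift[of j n] lin_ord_compl_prefix[OF ys, of j] by (auto simp: is_diag_def)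
    then show ?thesis unfolding S using ij
      by (intro diagsI2[OF zs] lin_ord_image_subset[OF ys]) (auto simp: is_diag_def)
  qed
qed

lemma diags_rev_subset:
  assumes ys: "lin_ord n ys"
  shows "diags n ys \<subseteq> diags n (rev ys)"
proof
  fix S assume "S \<in> diags n ys"
  then obtain i j where ij: "is_diag n i j" and S: "S = {(!) ys ` {i..<j}, {0..<n} - (!) ys ` {i..<j}}"
    using ys by (rule diagsE)
  have zs: "lin_ord n (rev ys)" using lin_ord_rev ys by simp
  have shift: "(!) ys ` {a..<b} = (!) (rev ys) ` {n - b..<n - a}" if "b \<le> n" for a b
  proof -
    have "(!) (rev ys) ` {n - b..<n - a} = (\<lambda>p. ys ! (n - Suc p)) ` {n - b..<n - a}"
      using that lin_ord_length[OF ys] by (intro image_cong) (auto simp: rev_nth)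
    also have "\<dots> = (!) ys ` ((\<lambda>p. n - Suc p) ` {n - b..<n - a})" by (simp only: image_image)
    also have "(\<lambda>p. n - Suc p) ` {n - b..<n - a} = {a..<b}"
    proof (intro set_eqI iffI)
      fix x assume "x \<in> {a..<b}"
      then show "x \<in> (\<lambda>p. n - Suc p) ` {n - b..<n - a}"
        using that by (intro image_eqI[of _ _ "n - Suc x"]) auto
    qed (use that in auto)
    finally show ?thesis by simp
  qed
  show "S \<in> diags n (rev ys)"
  proof (cases "i = 0")
    case False
    then have "is_diag n (n - j) (n - i)" using ij by (auto simp: is_diag_def)
    moreover have "(!) ys ` {i..<j} = (!) (rev ys) ` {n - j..<n - i}"
      using ij by (intro shift) (simp add: is_diag_def)
    ultimately show ?thesis unfolding S by (rule diagsI[OF zs])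
  next
    case True
    then have "is_diag n 0 (n - j)" using ij by (auto simp: is_diag_def)
    moreover have "{0..<n} - (!) ys ` {i..<j} = (!) (rev ys) ` {0..<n - j}"
      using ij True shift[of n j] lin_ord_compl_prefix[OF ys, of j] by (simp add: is_diag_def)
    ultimately show ?thesis unfolding S using ij
      by (intro diagsI2[OF zs] lin_ord_image_subset[OF ys]) (auto simp: is_diag_def)
  qed
qed

lemma diags_rotate_subset: "lin_ord n ys \<Longrightarrow> diags n ys \<subseteq> diags n (rotate k ys)"
proof (induction k)
  case (Suc k)
  then show ?case
    using diags_rotate1_subset[of n "rotate k ys"] by (auto simp: lin_ord_rotate)
qed auto

lemma rev_rotate_ex: "\<exists>m. rev (rotate k ys) = rotate m (rev ys)"
proof -
  have "rotate k ys = rev (rotate (length ys - k mod length ys) (rev ys))"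
    using rotate_rev[of k "rev ys"] by simp
  then show ?thesis by auto
qed

lemma rotate_inverse_ex: "\<exists>m. ys = rotate m (rotate k ys)"
proof (cases "ys = []")
  case False
  let ?m = "length ys - k mod length ys"
  have "k mod length ys \<le> length ys" using False by (simp add: less_imp_le)
  then have "(?m + k) mod length ys = 0"
    by (metis le_add_diff_inverse2 mod_add_right_eq mod_self)
  then have "ys = rotate ?m (rotate k ys)" by (simp add: rotate_rotate rotate_id)
  then show ?thesis ..
qed auto

lemma circ_ord_refl: "lin_ord n ys \<Longrightarrow> ys \<in> circ_ord n ys"
  unfolding circ_ord_def using rotate0 by (auto intro!: exI[of _ 0])

lemma circ_ord_sym:
  assumes "zs \<in> circ_ord n ys" "lin_ord n ys" shows "ys \<in> circ_ord n zs"
proof -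
  obtain k where "zs = rotate k ys \<or> zs = rotate k (rev ys)"
    using assms unfolding circ_ord_def by blast
  then have "\<exists>m. ys = rotate m zs \<or> ys = rotate m (rev zs)"
  proof
    assume "zs = rotate k ys"
    then show ?thesis using rotate_inverse_ex by blast
  next
    assume zs: "zs = rotate k (rev ys)"
    obtain m where "rev ys = rotate m zs" using rotate_inverse_ex zs by blast
    then have "ys = rev (rotate m zs)" by (metis rev_rev_ident)
    then show ?thesis using rev_rotate_ex[of m zs] by auto
  qed
  then show ?thesis using assms unfolding circ_ord_def by blast
qed

lemma circ_ord_trans:
  assumes "zs \<in> circ_ord n ys" "us \<in> circ_ord n zs" shows "us \<in> circ_ord n ys"
proof -
  obtain k where k: "zs = rotate k ys \<or> zs = rotate k (rev ys)"
    using assms unfolding circ_ord_def by blast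
  obtain m where m: "us = rotate m zs \<or> us = rotate m (rev zs)"
    using assms unfolding circ_ord_def by blast
  have "\<exists>k. us = rotate k ys \<or> us = rotate k (rev ys)"
    using k m rev_rotate_ex[of k ys] rev_rotate_ex[of k "rev ys"] by (auto simp: rotate_rotate)
  then show ?thesis using assms unfolding circ_ord_def by blast
qed

lemma circ_ord_eq:
  assumes "zs \<in> circ_ord n ys" "lin_ord n ys" shows "circ_ord n zs = circ_ord n ys"
  using circ_ord_trans circ_ord_sym assms by blast

lemma circ_orderingsE:
  assumes "\<pi> \<in> circ_orderings n" "ys \<in> \<pi>"
  shows "lin_ord n ys" "\<pi> = circ_ord n ys"
proof -
  obtain us where us: "lin_ord n us" "\<pi> = circ_ord n us"
    using assms unfolding circ_orderings_def by auto
  then show "lin_ord n ys" using assms unfolding circ_ord_def by blast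
  show "\<pi> = circ_ord n ys" using circ_ord_eq us assms by simp
qed

lemma circ_orderings_nonempty: "\<pi> \<in> circ_orderings n \<Longrightarrow> \<exists>ys. ys \<in> \<pi>"
  unfolding circ_orderings_def using circ_ord_refl by auto

lemma circ_ord_in: "lin_ord n ys \<Longrightarrow> circ_ord n ys \<in> circ_orderings n"
  unfolding circ_orderings_def by blast

lemma rotate_in_circ_ord: "lin_ord n ys \<Longrightarrow> rotate k ys \<in> circ_ord n ys"
  unfolding circ_ord_def by (auto simp: lin_ord_rotate)

lemma diags_subset_of_circ_ord:
  assumes "zs \<in> circ_ord n ys" "lin_ord n ys"
  shows "diags n ys \<subseteq> diags n zs"
proof -
  obtain k where "zs = rotate k ys \<or> zs = rotate k (rev ys)"
    using assms unfolding circ_ord_def by blast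
  then show ?thesis
    using diags_rotate_subset[OF assms(2)] diags_rev_subset[OF assms(2)]
      diags_rotate_subset[of n "rev ys"] assms(2) lin_ord_rev by blast
qed

lemma diags_eq_of_circ_ord:
  assumes "zs \<in> circ_ord n ys" "lin_ord n ys"
  shows "diags n zs = diags n ys"
  using assms diags_subset_of_circ_ord circ_ord_sym circ_ord_def by blast

lemma compat_diag_split_iff:
  assumes ys: "lin_ord n ys" and ij: "is_diag n i j" and kl: "is_diag n k l"
  shows "compat (diag_split ys i j) (diag_split ys k l) \<longleftrightarrow> \<not> crosses i j k l"
proof -
  let ?A = "(!) ys ` {i..<j}" and ?B = "(!) ys ` {k..<l}" and ?X = "{0..<n}"
  have d: "i < j" "j < n" "k < l" "l < n" using ij kl by (auto simp: is_diag_def)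
  have mem: "ys ! p \<in> ?A \<longleftrightarrow> i \<le> p \<and> p < j" "ys ! p \<in> ?B \<longleftrightarrow> k \<le> p \<and> p < l" "ys ! p \<in> ?X"
    if "p < n" for p
    using that d ys lin_ord_nth_mem_image_iff[OF ys, of p] lin_ord_nth_less[OF ys, of p] by auto
  have top: "ys ! (n - 1) \<notin> ?A" "ys ! (n - 1) \<notin> ?B" "ys ! (n - 1) \<in> ?X"
    using mem[of "n - 1"] d by auto
  have 1: "?A \<inter> ?B = {} \<longleftrightarrow> j \<le> k \<or> l \<le> i"
  proof
    assume "?A \<inter> ?B = {}"
    then have "ys ! i \<notin> ?A \<or> ys ! i \<notin> ?B" "ys ! k \<notin> ?A \<or> ys ! k \<notin> ?B" by blast+
    then show "j \<le> k \<or> l \<le> i" using d mem(1,2)[of i] mem(1,2)[of k] by linarith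
  next
    assume r: "j \<le> k \<or> l \<le> i"
    have "{i..<j} \<inter> {k..<l} = {}" using r by auto
    then show "?A \<inter> ?B = {}"
      using inj_on_image_Int[OF lin_ord_inj[OF ys], of "{i..<j}" "{k..<l}"] d by auto
  qed
  have 2: "?A \<inter> (?X - ?B) = {} \<longleftrightarrow> k \<le> i \<and> j \<le> l"
  proof
    assume "?A \<inter> (?X - ?B) = {}"
    then have "ys ! i \<notin> ?A \<or> ys ! i \<in> ?B" "ys ! (j - 1) \<notin> ?A \<or> ys ! (j - 1) \<in> ?B"
      using mem(3)[of i] mem(3)[of "j - 1"] d less_imp_diff_less[of j n 1]
        less_trans[of i j n] by blast+
    then show "k \<le> i \<and> j \<le> l" using d mem(1,2)[of i] mem(1,2)[of "j - 1"] by linarith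
  next
    assume "k \<le> i \<and> j \<le> l"
    then have "?A \<subseteq> ?B" by (intro image_mono) auto
    then show "?A \<inter> (?X - ?B) = {}" by blast
  qed
  have 3: "(?X - ?A) \<inter> ?B = {} \<longleftrightarrow> i \<le> k \<and> l \<le> j"
  proof
    assume "(?X - ?A) \<inter> ?B = {}"
    then have "ys ! k \<notin> ?B \<or> ys ! k \<in> ?A" "ys ! (l - 1) \<notin> ?B \<or> ys ! (l - 1) \<in> ?A"
      using mem(3)[of k] mem(3)[of "l - 1"] d less_imp_diff_less[of l n 1]
        less_trans[of k l n] by blast+
    then show "i \<le> k \<and> l \<le> j" using d mem(1,2)[of k] mem(1,2)[of "l - 1"] by linarith
  next
    assume "i \<le> k \<and> l \<le> j"
    then have "?B \<subseteq> ?A" by (intro image_mono) auto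
    then show "(?X - ?A) \<inter> ?B = {}" by blast
  qed
  have 4: "(?X - ?A) \<inter> (?X - ?B) \<noteq> {}" using top by blast
  have "compat (diag_split ys i j) (diag_split ys k l) \<longleftrightarrow>
      j \<le> k \<or> l \<le> i \<or> (k \<le> i \<and> j \<le> l) \<or> (i \<le> k \<and> l \<le> j)"
    using diag_split_eq[OF ys, of j i] diag_split_eq[OF ys, of l k] d 1 2 3 4
    unfolding compat_def by simp
  also have "\<dots> \<longleftrightarrow> \<not> crosses i j k l" unfolding crosses_def using d by linarith
  finally show ?thesis .
qed

lemma diag_split_inj:
  assumes ys: "lin_ord n ys" and ij: "is_diag n i j" and kl: "is_diag n k l"
    and eq: "diag_split ys i j = diag_split ys k l"
  shows "i = k \<and> j = l"
proof -
  let ?A = "(!) ys ` {i..<j}" and ?B = "(!) ys ` {k..<l}"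
  have d: "i < j" "j < n" "k < l" "l < n" using ij kl by (auto simp: is_diag_def)
  have "{?A, {0..<n} - ?A} = {?B, {0..<n} - ?B}"
    using eq diag_split_eq[OF ys, of j i] diag_split_eq[OF ys, of l k] d by simp
  moreover have "ys ! (n - 1) \<in> {0..<n} - ?B" "ys ! (n - 1) \<notin> ?A"
    using d lin_ord_nth_mem_image_iff[OF ys, of "n - 1"] lin_ord_nth_less[OF ys, of "n - 1"] by auto
  ultimately have "?A = ?B" by (metis doubleton_eq_iff)
  then have "{i..<j} = {k..<l}"
    using inj_on_image_eq_iff[OF lin_ord_inj[OF ys], of "{i..<j}" "{k..<l}"] d by auto
  then show ?thesis using d by (simp add: atLeastLessThan_eq_iff)
qed

lemma noncrossing_iff:
  assumes pi: "\<pi> \<in> circ_orderings n" and ys: "ys \<in> \<pi>"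
  shows "noncrossing n \<pi> D \<longleftrightarrow> D \<subseteq> diags n ys \<and> (\<forall>S\<in>D. \<forall>S'\<in>D. compat S S')"
proof -
  have lin: "lin_ord n zs" "diags n zs = diags n ys" if "zs \<in> \<pi>" for zs
    using that circ_orderingsE[OF pi] ys diags_eq_of_circ_ord by (blast, metis)
  have "(\<forall>i j k l. is_diag n i j \<and> is_diag n k l \<and> diag_split zs i j \<in> D \<and> diag_split zs k l \<in> D
          \<longrightarrow> \<not> crosses i j k l) \<longleftrightarrow> (\<forall>S\<in>D. \<forall>S'\<in>D. compat S S')"
    if "zs \<in> \<pi>" "D \<subseteq> diags n ys" for zs
  proof -
    have "D \<subseteq> diags n zs" using that lin(2) by simp
    then have ex: "\<exists>i j. is_diag n i j \<and> S = diag_split zs i j" if "S \<in> D" for S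
      using that unfolding diags_def by blast
    note iff = compat_diag_split_iff[OF lin(1)[OF \<open>zs \<in> \<pi>\<close>]]
    show ?thesis
    proof (intro iffI ballI allI impI)
      fix S S' assume cr: "\<forall>i j k l. is_diag n i j \<and> is_diag n k l \<and> diag_split zs i j \<in> D \<and>
        diag_split zs k l \<in> D \<longrightarrow> \<not> crosses i j k l" and S: "S \<in> D" "S' \<in> D"
      obtain i j k l where "is_diag n i j" "S = diag_split zs i j" "is_diag n k l" "S' = diag_split zs k l"
        using ex S by blast
      then show "compat S S'" using iff cr S by blast
    qed (use iff in blast)
  qed
  then have "D \<subseteq> diags n zs \<and> (\<forall>i j k l. is_diag n i j \<and> is_diag n k l \<and> diag_split zs i j \<in> D \<and>
      diag_split zs k l \<in> D \<longrightarrow> \<not> crosses i j k l) \<longleftrightarrow>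
      D \<subseteq> diags n ys \<and> (\<forall>S\<in>D. \<forall>S'\<in>D. compat S S')" if "zs \<in> \<pi>" for zs
    using that lin(2)[OF that] by auto
  then show ?thesis unfolding noncrossing_def diags_def[symmetric] using ys by blast
qed

lemma noncrossing_compat:
  assumes pi: "\<pi> \<in> circ_orderings n" and D: "noncrossing n \<pi> D" and S: "S \<in> D" "S' \<in> D"
  shows "compat S S'"
proof -
  obtain ys where "ys \<in> \<pi>" using pi circ_orderings_nonempty by blast
  then show ?thesis using D S unfolding noncrossing_iff[OF pi \<open>ys \<in> \<pi>\<close>] by simp
qed

lemma finite_noncrossing:
  assumes "\<pi> \<in> circ_orderings n" shows "finite {D. noncrossing n \<pi> D}"
proof -
  obtain ys where "ys \<in> \<pi>" using assms circ_orderings_nonempty by blast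
  then have "{D. noncrossing n \<pi> D} \<subseteq> Pow (diags n ys)" using noncrossing_iff assms by blast
  then show ?thesis using finite_subset finite_diags by blast
qed

lemma noncrossing_subset:
  assumes "\<pi> \<in> circ_orderings n" "noncrossing n \<pi> D" "E \<subseteq> D" shows "noncrossing n \<pi> E"
proof -
  obtain ys where "ys \<in> \<pi>" using assms circ_orderings_nonempty by blast
  then show ?thesis using noncrossing_iff[OF assms(1)] assms(2,3) by blast
qed

section \<open>Twists and triangulations\<close>


lemma twist_step_diags:
  assumes pi: "\<pi> \<in> circ_orderings n" and tw: "twist_step n \<pi> d \<pi>'"
    and T: "noncrossing n \<pi> T" "d \<in> T"
  shows "\<pi>' \<in> circ_orderings n" "noncrossing n \<pi>' T" "twist_step n \<pi>' d \<pi>"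
proof -
  obtain ys k where ys: "ys \<in> \<pi>" and k: "0 < k" "k < n"
    and d: "d = {set (take k ys), set (drop k ys)}" and pi': "\<pi>' = circ_ord n (rev (take k ys) @ drop k ys)"
    using tw unfolding twist_step_def by blast
  define zs where "zs = rev (take k ys) @ drop k ys"
  have lin: "lin_ord n ys" and pieq: "\<pi> = circ_ord n ys" using circ_orderingsE[OF pi ys] .
  have len: "length ys = n" using lin by (rule lin_ord_length)
  have "set zs = set (take k ys @ drop k ys)" unfolding zs_def set_append by simp
  moreover have "distinct zs"
    using lin set_take_disj_set_drop_if_distinct[of ys k k] unfolding zs_def lin_ord_def by simp
  ultimately have linz: "lin_ord n zs" using lin by (simp add: lin_ord_def)
  have pi'z: "\<pi>' = circ_ord n zs" using pi' zs_def by simp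
  show pi'in: "\<pi>' \<in> circ_orderings n" using pi'z linz circ_ord_in by simp
  have zs_in: "zs \<in> \<pi>'" using pi'z linz circ_ord_refl by simp
  have lk: "length (take k ys) = k" using len k by simp
  have tz: "take k zs = rev (take k ys)" "drop k zs = drop k ys" unfolding zs_def using lk by simp_all
  then have "rev (take k zs) @ drop k zs = ys" by simp
  moreover have "d = {set (take k zs), set (drop k zs)}" using tz d by simp
  ultimately show "twist_step n \<pi>' d \<pi>"
    unfolding twist_step_def using zs_in k pieq by (intro bexI[of _ zs] exI[of _ k]) auto
  have nth: "zs ! p = (if p < k then ys ! (k - Suc p) else ys ! p)" if "p < n" for p
    using that lk len unfolding zs_def by (auto simp: nth_append rev_nth)
  have d': "d = {(!) ys ` {0..<k}, (!) ys ` {k..<n}}"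
    using d set_take_drop_eq_image[of k ys 0] set_take_drop_eq_image[of n ys k] len k by simp
  have "S \<in> diags n zs" if "S \<in> T" for S
  proof -
    have "S \<in> diags n ys" "compat S d" using that T noncrossing_iff[OF pi ys] by blast+
    then obtain i j where ij: "is_diag n i j" and S: "S = {(!) ys ` {i..<j}, {0..<n} - (!) ys ` {i..<j}}"
      using lin diagsE by metis
    have dj: "i < j" "j < n" using ij by (auto simp: is_diag_def)
    have mem: "ys ! p \<in> (!) ys ` {i..<j} \<longleftrightarrow> i \<le> p \<and> p < j" "ys ! p < n" if "p < n" for p
      using that dj lin_ord_nth_mem_image_iff[OF lin, of p] lin_ord_nth_less[OF lin, of p] by auto
    have "j \<le> k \<or> k \<le> i \<or> (i = 0 \<and> k \<le> j)"
    proof (rule ccontr)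
      assume no: "\<not> (j \<le> k \<or> k \<le> i \<or> (i = 0 \<and> k \<le> j))"
      have k1: "k - 1 < n" "n - 1 < n" using k by auto
      have "ys ! (k - 1) \<in> (!) ys ` {i..<j} \<inter> (!) ys ` {0..<k}" using no k mem(1)[of "k - 1"] by auto
      moreover have "ys ! k \<in> (!) ys ` {i..<j} \<inter> (!) ys ` {k..<n}" using no k mem(1)[of k] by auto
      moreover have "ys ! 0 \<in> ({0..<n} - (!) ys ` {i..<j}) \<inter> (!) ys ` {0..<k}"
        using no k mem[of 0] by auto
      moreover have "ys ! (n - 1) \<in> ({0..<n} - (!) ys ` {i..<j}) \<inter> (!) ys ` {k..<n}"
        using no k dj mem[OF k1(2)] by auto
      ultimately have "\<not> compat S d" unfolding compat_def S d' by blast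
      then show False using \<open>compat S d\<close> by blast
    qed
    moreover have ?thesis if "j \<le> k"
    proof -
      have "is_diag n (k - j) (k - i)" using that ij k by (auto simp: is_diag_def)
      moreover have "(!) ys ` {i..<j} = (!) zs ` {k - j..<k - i}"
      proof -
        have "(!) zs ` {k - j..<k - i} = (\<lambda>p. ys ! (k - Suc p)) ` {k - j..<k - i}"
          using that k by (intro image_cong) (auto simp: nth)
        also have "\<dots> = (!) ys ` ((\<lambda>p. k - Suc p) ` {k - j..<k - i})" by (simp only: image_image)
        also have "(\<lambda>p. k - Suc p) ` {k - j..<k - i} = {i..<j}"
        proof (intro set_eqI iffI)
          fix x assume "x \<in> {i..<j}"
          then show "x \<in> (\<lambda>p. k - Suc p) ` {k - j..<k - i}"
            using that by (intro image_eqI[of _ _ "k - Suc x"]) auto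
        qed (use that in auto)
        finally show ?thesis by simp
      qed
      ultimately show ?thesis unfolding S by (rule diagsI[OF linz])
    qed
    moreover have ?thesis if "k \<le> i"
    proof -
      have "(!) ys ` {i..<j} = (!) zs ` {i..<j}"
        using that dj by (intro image_cong) (auto simp: nth)
      then show ?thesis unfolding S using diagsI[OF linz ij] by simp
    qed
    moreover have ?thesis if "i = 0 \<and> k \<le> j"
    proof -
      have "{0..<n} - (!) ys ` {i..<j} = (!) ys ` {j..<n}"
        using that dj lin_ord_compl_prefix[OF lin, of j] by simp
      also have "\<dots> = (!) zs ` {j..<n}"
        using that dj by (intro image_cong) (auto simp: nth)
      also have "\<dots> = {0..<n} - (!) zs ` {i..<j}"
        using that dj lin_ord_compl_prefix[OF linz, of j] by simp
      finally have "(!) ys ` {i..<j} = (!) zs ` {i..<j}"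
        using lin_ord_image_subset[OF lin, of j i] lin_ord_image_subset[OF linz, of j i] dj
        by (metis double_diff less_imp_le order_refl)
      then show ?thesis unfolding S using diagsI[OF linz ij] by simp
    qed
    ultimately show ?thesis by blast
  qed
  then show "noncrossing n \<pi>' T"
    using T noncrossing_iff[OF pi'in zs_in] noncrossing_iff[OF pi ys] by blast
qed

lemma twists_noncrossing:
  assumes "twists n D \<pi> \<pi>'" "\<pi> \<in> circ_orderings n" "noncrossing n \<pi> D"
  shows "\<pi>' \<in> circ_orderings n \<and> (\<forall>T. D \<subseteq> T \<longrightarrow> noncrossing n \<pi> T = noncrossing n \<pi>' T)"
  using assms(1) unfolding twists_def
proof (induction rule: rtranclp_induct)
  case base
  then show ?case using assms by simp
next
  case (step y z)
  then obtain d where d: "d \<in> D" "twist_step n y d z" by blast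
  have yD: "noncrossing n y D" using step assms(3) by blast
  note st = twist_step_diags[OF _ d(2)]
  have z: "z \<in> circ_orderings n" "twist_step n z d y"
    using st[OF _ yD d(1)] step.IH by blast+
  have "noncrossing n y T = noncrossing n z T" if "D \<subseteq> T" for T
    using st(2)[of T] twist_step_diags(2)[OF z, of T] that d(1) step.IH by blast
  then show ?case using z step.IH by blast
qed

lemma twists_triangulation:
  assumes "twists n D \<pi> \<pi>'" "\<pi> \<in> circ_orderings n" "noncrossing n \<pi> D" "D \<subseteq> T"
  shows "triangulation n \<pi> T = triangulation n \<pi>' T"
  unfolding triangulation_def using twists_noncrossing[OF assms(1-3)] assms(4) by (meson subset_trans)

lemma twists_Phi_face:
  assumes "twists n D \<pi> \<pi>'" "\<pi> \<in> circ_orderings n" "noncrossing n \<pi> D" "D \<subseteq> E"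
  shows "Phi_face n \<pi> E = Phi_face n \<pi>' E"
proof -
  have "{T. triangulation n \<pi> T \<and> E \<subseteq> T} = {T. triangulation n \<pi>' T \<and> E \<subseteq> T}"
    using twists_triangulation[OF assms(1-3)] assms(4) by (blast intro: subset_trans)
  then show ?thesis unfolding Phi_face_def by simp
qed

lemma Phi_pt_eq_sum_superset:
  assumes "K_point n \<pi> w" "finite F" "{D. noncrossing n \<pi> D} \<subseteq> F"
  shows "Phi_pt n \<pi> w S = (\<Sum>D\<in>F. w D * Phi_face n \<pi> D S)"
  unfolding Phi_pt_def using assms unfolding K_point_def
  by (intro sum.mono_neutral_left) auto

lemma ident_imp_Phi_eq:
  assumes "ident n p q" shows "Phi n p = Phi n q"
proof -
  obtain \<pi> w \<pi>' where pq: "p = (\<pi>, w)" "q = (\<pi>', w)"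
    using assms unfolding ident_def by (metis prod.collapse)
  have K: "\<pi> \<in> circ_orderings n" "K_point n \<pi> w" "\<pi>' \<in> circ_orderings n" "K_point n \<pi>' w"
    using assms pq unfolding ident_def Kspace_def by auto
  obtain D where D: "noncrossing n \<pi> D" "twists n D \<pi> \<pi>'" "\<And>E. w E \<noteq> 0 \<Longrightarrow> D \<subseteq> E"
    using assms pq unfolding ident_def by auto
  let ?F = "{D. noncrossing n \<pi> D} \<union> {D. noncrossing n \<pi>' D}"
  have fin: "finite ?F" using finite_noncrossing K by simp
  have "Phi_pt n \<pi> w S = Phi_pt n \<pi>' w S" for S
  proof -
    have "Phi_pt n \<pi> w S = (\<Sum>E\<in>?F. w E * Phi_face n \<pi> E S)"
      by (rule Phi_pt_eq_sum_superset[OF K(2) fin]) auto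
    also have "\<dots> = (\<Sum>E\<in>?F. w E * Phi_face n \<pi>' E S)"
    proof (rule sum.cong[OF refl])
      fix E
      show "w E * Phi_face n \<pi> E S = w E * Phi_face n \<pi>' E S"
        using twists_Phi_face[OF D(2) K(1) D(1), of E] D(3)[of E] by (cases "w E = 0") auto
    qed
    also have "\<dots> = Phi_pt n \<pi>' w S"
      by (rule Phi_pt_eq_sum_superset[OF K(4) fin, symmetric]) auto
    finally show ?thesis .
  qed
  then show ?thesis unfolding Phi_def pq by auto
qed

lemma triangulation_extend:
  assumes "\<pi> \<in> circ_orderings n" "noncrossing n \<pi> D"
  obtains T where "triangulation n \<pi> T" "D \<subseteq> T"
proof -
  obtain T where "T \<in> {D. noncrossing n \<pi> D}" "D \<subseteq> T"
    "\<forall>T'\<in>{D. noncrossing n \<pi> D}. T \<subseteq> T' \<longrightarrow> T = T'"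
    using finite_has_maximal2[OF finite_noncrossing[OF assms(1)], of D] assms(2) by auto
  then show thesis using that unfolding triangulation_def by blast
qed

lemma triangulation_finite: "\<pi> \<in> circ_orderings n \<Longrightarrow> finite {T. triangulation n \<pi> T \<and> P T}"
  by (rule finite_subset[OF _ finite_noncrossing]) (auto simp: triangulation_def)

lemma card_maximal_noncrossing_chords:
  fixes Q :: "(nat \<times> nat) set"
  assumes fin: "finite Q"
    and len: "\<And>i j. (i, j) \<in> Q \<Longrightarrow> i + 2 \<le> j"
    and cr: "\<And>i j k l. (i, j) \<in> Q \<Longrightarrow> (k, l) \<in> Q \<Longrightarrow> \<not> crosses i j k l"
    and mx: "\<And>a b. a + 2 \<le> b \<Longrightarrow> b \<le> N \<Longrightarrow> (\<forall>(i, j)\<in>Q. \<not> crosses a b i j) \<Longrightarrow> (a, b) \<in> Q"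
    and "a < b" "b \<le> N" "b = a + 1 \<or> (a, b) \<in> Q"
  shows "card {(i, j) \<in> Q. a \<le> i \<and> j \<le> b} = b - a - 1"
  using assms(5-7)
proof (induction "b - a" arbitrary: a b rule: less_induct)
  case less
  show ?case
  proof (cases "b = a + 1")
    case True
    then have "{(i, j) \<in> Q. a \<le> i \<and> j \<le> b} = {}" using len by fastforce
    then show ?thesis using True by (simp only: card.empty)
  next
    case False
    then have ab: "(a, b) \<in> Q" "a + 2 \<le> b" using less by auto
    define K where "K = {k. a < k \<and> k < b \<and> (k = a + 1 \<or> (a, k) \<in> Q)}"
    have K: "finite K" "a + 1 \<in> K" unfolding K_def using ab by auto
    define k where "k = Max K"
    have kK: "k \<in> K" unfolding k_def using K by (intro Max_in) auto
    then have k: "a < k" "k < b" "k = a + 1 \<or> (a, k) \<in> Q" unfolding K_def by auto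
    have kmax: "m \<le> k" if "(a, m) \<in> Q" "m < b" for m
      using that K len[of a m] unfolding k_def K_def by (intro Max_ge) auto
    have left: "i < k \<Longrightarrow> k < j \<Longrightarrow> a \<le> i \<Longrightarrow> j \<le> b \<Longrightarrow> i = a \<and> j = b" if "(i, j) \<in> Q" for i j
    proof -
      assume h: "i < k" "k < j" "a \<le> i" "j \<le> b"
      have "i = a"
      proof (rule ccontr)
        assume "i \<noteq> a"
        then have "(a, k) \<in> Q" using k h by auto
        then have "\<not> crosses a k i j" using cr that by blast
        then show False using h \<open>i \<noteq> a\<close> unfolding crosses_def by auto
      qed
      then show ?thesis using kmax[of j] that h by fastforce
    qed
    have kb: "b = k + 1 \<or> (k, b) \<in> Q"
    proof (cases "b = k + 1")
      case False
      have "\<not> crosses k b i j" if ij: "(i, j) \<in> Q" for i j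
        using cr[OF ab(1) ij] left[OF ij] k len[OF ij] unfolding crosses_def by auto
      then have "(k, b) \<in> Q" using k less.prems False by (intro mx) auto
      then show ?thesis ..
    qed simp
    let ?R = "\<lambda>a b. {(i, j) \<in> Q. a \<le> i \<and> j \<le> b}"
    have fR: "finite (?R c d)" for c d using fin by (rule rev_finite_subset) auto
    have "?R a b = insert (a, b) (?R a k \<union> ?R k b)"
      using ab left k by fastforce
    then have "card (?R a b) = card (insert (a, b) (?R a k \<union> ?R k b))" by (rule arg_cong)
    also have "\<dots> = Suc (card (?R a k \<union> ?R k b))"
      using k fR by (intro card_insert_disjoint finite_UnI) auto
    also have "card (?R a k \<union> ?R k b) = card (?R a k) + card (?R k b)"
      using len k fR by (intro card_Un_disjoint) fastforce+
    also have "card (?R a k) = k - a - 1" using k less.prems by (intro less.hyps) auto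
    also have "card (?R k b) = b - k - 1" using k kb less.prems by (intro less.hyps) auto
    finally show ?thesis using k by simp
  qed
qed

lemma triangulation_card:
  assumes n: "4 \<le> n" and pi: "\<pi> \<in> circ_orderings n" and T: "triangulation n \<pi> T"
  shows "card T = n - 3"
proof -
  obtain ys where ys: "ys \<in> \<pi>" using circ_orderings_nonempty[OF pi] by blast
  have lin: "lin_ord n ys" using circ_orderingsE[OF pi ys] by simp
  have nc: "T \<subseteq> diags n ys" "\<And>S S'. S \<in> T \<Longrightarrow> S' \<in> T \<Longrightarrow> compat S S'"
    using T noncrossing_iff[OF pi ys] unfolding triangulation_def by blast+
  define P where "P = {(i, j). is_diag n i j \<and> diag_split ys i j \<in> T}"
  \<comment> \<open>adding the side \<open>(0, n - 1)\<close> gives the induction its outermost chord\<close>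
  define Q where "Q = insert (0, n - 1) P"
  have finP: "finite P"
    by (rule finite_subset[of _ "{..<n} \<times> {..<n}"]) (auto simp: P_def is_diag_def)
  have ncP: "\<not> crosses i j k l" if "(i, j) \<in> P" "(k, l) \<in> P" for i j k l
    using that nc compat_diag_split_iff[OF lin] unfolding P_def by blast
  have Pd: "i < j \<and> j \<le> n - 1 \<and> i + 2 \<le> j" if "(i, j) \<in> P" for i j
    using that unfolding P_def is_diag_def by auto
  have bij: "bij_betw (\<lambda>(i, j). diag_split ys i j) P T"
    unfolding bij_betw_def
  proof
    show "inj_on (\<lambda>(i, j). diag_split ys i j) P"
      unfolding inj_on_def P_def using diag_split_inj[OF lin] by auto
    show "(\<lambda>(i, j). diag_split ys i j) ` P = T"
      using nc(1) unfolding P_def diags_def by fastforce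
  qed
  have "card {(i, j) \<in> Q. 0 \<le> i \<and> j \<le> n - 1} = n - 1 - 0 - 1"
  proof (rule card_maximal_noncrossing_chords[of Q "n - 1"])
    show "finite Q" using finP by (simp add: Q_def)
    show "i + 2 \<le> j" if "(i, j) \<in> Q" for i j using that Pd n by (auto simp: Q_def)
    show "\<not> crosses i j k l" if "(i, j) \<in> Q" "(k, l) \<in> Q" for i j k l
      using that ncP Pd unfolding Q_def crosses_def by fastforce
    show "(a, b) \<in> Q" if ab: "a + 2 \<le> b" "b \<le> n - 1" "\<forall>(i, j)\<in>Q. \<not> crosses a b i j" for a b
    proof (cases "a = 0 \<and> b = n - 1")
      case False
      then have d: "is_diag n a b" using ab n unfolding is_diag_def by auto
      have "compat (diag_split ys a b) S \<and> compat S (diag_split ys a b)" if ST: "S \<in> T" for S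
      proof -
        obtain i j where "(i, j) \<in> P" "S = diag_split ys i j"
          using ST nc(1) unfolding P_def diags_def by blast
        moreover have "\<not> crosses a b i j" "\<not> crosses i j a b"
          using ab(3) \<open>(i, j) \<in> P\<close> unfolding Q_def crosses_def by auto
        ultimately show ?thesis using compat_diag_split_iff[OF lin] d unfolding P_def by auto
      qed
      moreover have "compat (diag_split ys a b) (diag_split ys a b)"
        using compat_diag_split_iff[OF lin d d] by (simp add: crosses_def)
      ultimately have "noncrossing n \<pi> (insert (diag_split ys a b) T)"
        using nc d unfolding noncrossing_iff[OF pi ys] by (auto simp: diags_def)
      then have "insert (diag_split ys a b) T = T" using T unfolding triangulation_def by blast
      then show ?thesis using d unfolding Q_def P_def by auto
    qed (auto simp: Q_def)
  qed (use n in \<open>auto simp: Q_def\<close>)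
  moreover have "{(i, j) \<in> Q. 0 \<le> i \<and> j \<le> n - 1} = Q" unfolding Q_def using Pd by auto
  moreover have "(0, n - 1) \<notin> P" unfolding P_def is_diag_def using n by auto
  ultimately have "Suc (card P) = n - 2" using finP by (simp add: Q_def)
  then show ?thesis using bij_betw_same_card[OF bij] by simp
qed

lemma triangulation_avoiding:
  assumes n: "4 \<le> n" and pi: "\<pi> \<in> circ_orderings n" and D: "noncrossing n \<pi> D" and S: "S \<notin> D"
  obtains T where "triangulation n \<pi> T" "D \<subseteq> T" "S \<notin> T"
proof (cases "noncrossing n \<pi> (insert S D)")
  case False
  obtain T where T: "triangulation n \<pi> T" "D \<subseteq> T" using triangulation_extend pi D by blast
  then have "S \<notin> T" using False noncrossing_subset[OF pi, of T "insert S D"]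
    unfolding triangulation_def by blast
  then show thesis using that T by blast
next
  case True
  obtain us where us: "us \<in> \<pi>" using circ_orderings_nonempty[OF pi] by blast
  have linu: "lin_ord n us" "\<pi> = circ_ord n us" using circ_orderingsE[OF pi us] by auto
  obtain i m where im: "is_diag n i m" "S = diag_split us i m"
    using True noncrossing_iff[OF pi us] linu(1) diagsE by (metis insert_subset)
  define ys where "ys = rotate i us"
  define j where "j = m - i"
  have ys: "ys \<in> \<pi>" unfolding ys_def linu(2) using rotate_in_circ_ord linu(1) .
  have lin: "lin_ord n ys" using circ_orderingsE[OF pi ys] by simp
  have dj: "is_diag n 0 j" using im unfolding j_def is_diag_def by auto
  have "(!) ys ` {0..<j} = (\<lambda>p. us ! (i + p)) ` {0..<j}"
    using im lin_ord_length[OF linu(1)] unfolding ys_def j_def is_diag_def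
    by (intro image_cong) (auto simp: nth_rotate)
  also have "\<dots> = (!) us ` ((+) i ` {0..<j})" by (simp only: image_image)
  also have "(+) i ` {0..<j} = {i..<m}" using im unfolding j_def is_diag_def by auto
  finally have Sj: "S = diag_split ys 0 j"
    using im dj diag_split_eq[OF lin, of j 0] diag_split_eq[OF linu(1), of m i]
    by (simp add: is_diag_def)
  have j: "2 \<le> j" "j + 2 \<le> n" using dj unfolding is_diag_def by auto
  define P where "P = {(i, j). is_diag n i j \<and> diag_split ys i j \<in> D}"
  have nc: "insert S D \<subseteq> diags n ys" "\<And>S1 S2. S1 \<in> insert S D \<Longrightarrow> S2 \<in> insert S D \<Longrightarrow> compat S1 S2"
    using True unfolding noncrossing_iff[OF pi ys] by blast+
  have ncP: "\<not> crosses i j k l" if "(i, j) \<in> P" "(k, l) \<in> P" for i j k l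
    using that nc(2)[of "diag_split ys i j" "diag_split ys k l"]
      compat_diag_split_iff[OF lin, of i j k l] unfolding P_def by auto
  have jP: "(0, j) \<notin> P" using S Sj unfolding P_def by auto
  define K where "K = {k. 0 < k \<and> k < j \<and> (k = 1 \<or> (0, k) \<in> P)}"
  define L where "L = {l. j < l \<and> l < n \<and> (l = n - 1 \<or> (0, l) \<in> P)}"
  have KL: "finite K" "1 \<in> K" "finite L" "n - 1 \<in> L" unfolding K_def L_def using j by auto
  define k where "k = Max K"
  define l where "l = Min L"
  have "k \<in> K" "l \<in> L" unfolding k_def l_def using KL by (auto intro!: Max_in Min_in)
  then have kl: "0 < k" "k < j" "k = 1 \<or> (0, k) \<in> P" "j < l" "l < n" "l = n - 1 \<or> (0, l) \<in> P"
    unfolding K_def L_def by auto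
  have bounds: "b \<le> k \<or> l \<le> b" if "(0, b) \<in> P" for b
  proof -
    have b: "0 < b" "b < n" using that unfolding P_def is_diag_def by auto
    have "b \<noteq> j" using jP that by auto
    then consider "b < j" | "b > j" by linarith
    then show ?thesis
    proof cases
      case 1
      then have "b \<in> K" using that b unfolding K_def by auto
      then show ?thesis unfolding k_def using KL by simp
    next
      case 2
      then have "b \<in> L" using that b unfolding L_def by auto
      then show ?thesis unfolding l_def using KL by simp
    qed
  qed
  have dkl: "is_diag n k l" using kl unfolding is_diag_def by auto
  have nckl: "\<not> crosses a b k l" if ab: "(a, b) \<in> P" for a b
  proof
    have b: "a < b" "b < n" using ab unfolding P_def is_diag_def by auto
    assume "crosses a b k l"
    then consider "a < k" "k < b" "b < l" | "k < a" "a < l" "l < b" unfolding crosses_def by blast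
    then show False
    proof cases
      case 1
      show ?thesis
      proof (cases "a = 0")
        case True
        then show ?thesis using bounds[of b] ab 1 by simp
      next
        case False
        then have "(0, k) \<in> P" using kl 1 by auto
        then show ?thesis using ncP[of 0 k a b] ab False 1 unfolding crosses_def by auto
      qed
    next
      case 2
      then have "(0, l) \<in> P" using kl b by auto
      then show ?thesis using ncP[of 0 l a b] ab 2 unfolding crosses_def by auto
    qed
  qed
  \<comment> \<open>the flip of \<open>S\<close> in a quadrilateral with vertices \<open>0, k, j, l\<close>\<close>
  define S' where "S' = diag_split ys k l"
  have "compat S' S1 \<and> compat S1 S'" if SD: "S1 \<in> D" for S1
  proof -
    obtain a b where ab: "(a, b) \<in> P" "S1 = diag_split ys a b"
      using SD subsetD[OF nc(1), of S1] unfolding P_def diags_def by auto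
    have "\<not> crosses k l a b" using nckl[OF ab(1)] unfolding crosses_def by auto
    then show ?thesis using compat_diag_split_iff[OF lin] dkl nckl[OF ab(1)] ab unfolding P_def S'_def by auto
  qed
  moreover have "compat S' S'"
    unfolding S'_def using compat_diag_split_iff[OF lin dkl dkl] by (simp add: crosses_def)
  ultimately have "noncrossing n \<pi> (insert S' D)"
    using nc dkl unfolding noncrossing_iff[OF pi ys] by (auto simp: diags_def S'_def)
  then obtain T where T: "triangulation n \<pi> T" "insert S' D \<subseteq> T" using triangulation_extend pi by blast
  have "crosses 0 j k l" using kl unfolding crosses_def by auto
  then have "\<not> compat S S'" unfolding Sj S'_def using compat_diag_split_iff[OF lin dj dkl] by simp
  moreover have "noncrossing n \<pi> T" "S' \<in> T" using T unfolding triangulation_def by auto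
  ultimately have "S \<notin> T" using noncrossing_compat[OF pi, of T S S'] by blast
  then show thesis using that T by blast
qed

section \<open>Orderings in which a laminar family is convex\<close>


definition convex_wrt :: "'a set \<Rightarrow> ('a \<Rightarrow> nat) \<Rightarrow> 'a set \<Rightarrow> bool" where
  "convex_wrt W f A \<longleftrightarrow> (\<forall>a\<in>A. \<forall>c\<in>A. \<forall>b\<in>W. f a < f b \<and> f b < f c \<longrightarrow> b \<in> A)"

definition laminar :: "'a set \<Rightarrow> 'a set \<Rightarrow> bool" where
  "laminar A B \<longleftrightarrow> A \<inter> B = {} \<or> A \<subseteq> B \<or> B \<subseteq> A"

definition sep :: "'a set set \<Rightarrow> 'a set \<Rightarrow> 'a \<Rightarrow> 'a \<Rightarrow> bool" where
  "sep \<B> M x y \<longleftrightarrow> x \<in> M \<and> y \<in> M \<and> x \<noteq> y \<and> (\<forall>N\<in>\<B>. x \<in> N \<and> y \<in> N \<longrightarrow> M \<subseteq> N)"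

lemma sep_commute: "sep \<B> M x y \<Longrightarrow> sep \<B> M y x"
  unfolding sep_def by blast

lemma nonbetween_preserved:
  fixes f g :: "'a \<Rightarrow> nat"
  assumes inj: "inj_on f W"
    and BW: "\<And>A. A \<in> \<B> \<Longrightarrow> A \<subseteq> W"
    and lam: "\<And>A B. A \<in> \<B> \<Longrightarrow> B \<in> \<B> \<Longrightarrow> laminar A B"
    and cf: "\<And>A. A \<in> \<B> \<Longrightarrow> convex_wrt W f A"
    and U: "\<And>I. I \<subset> W \<Longrightarrow> \<exists>x\<in>I. \<exists>y\<in>I. x \<noteq> y \<Longrightarrow> \<forall>A\<in>\<B>. laminar I A \<Longrightarrow>
        convex_wrt W f I \<Longrightarrow> convex_wrt W g I"
    and M: "M \<in> \<B>" and sxy: "sep \<B> M x y" and sxz: "sep \<B> M x z" and syz: "sep \<B> M y z"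
    and fxy: "f x < f y" and fz: "f z < f x \<or> f y < f z"
  shows "\<not> (g x < g z \<and> g z < g y) \<and> \<not> (g y < g z \<and> g z < g x)"
proof -
  define J where "J = {w \<in> W. f x \<le> f w \<and> f w \<le> f y}"
  \<comment> \<open>the interval from \<open>x\<close> to \<open>y\<close>, rounded up to whole blocks inside \<open>M\<close>\<close>
  define I where "I = J \<union> \<Union>{N \<in> \<B>. N \<subset> M \<and> N \<inter> J \<noteq> {}}"
  have mem: "x \<in> M" "y \<in> M" "z \<in> M" "x \<in> W" "y \<in> W" "z \<in> W"
    using sxy sxz BW[OF M] unfolding sep_def by auto
  have xyJ: "x \<in> J" "y \<in> J" unfolding J_def using mem fxy by auto
  have inW: "f a = f b \<longleftrightarrow> a = b" if "a \<in> W" "b \<in> W" for a b using inj that by (auto simp: inj_on_def)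
  have JM: "J \<subseteq> M"
  proof
    fix w assume w: "w \<in> J"
    show "w \<in> M"
    proof (cases "w = x \<or> w = y")
      case False
      then have "f x < f w" "f w < f y" using w inW[of w x] inW[of w y] mem unfolding J_def by auto
      then show ?thesis using cf[OF M] mem w unfolding convex_wrt_def J_def by blast
    qed (use mem in auto)
  qed
  have IM: "I \<subseteq> M" unfolding I_def using JM by auto
  have zI: "z \<notin> I"
  proof
    assume "z \<in> I"
    then obtain N where N: "N \<in> \<B>" "N \<subset> M" "N \<inter> J \<noteq> {}" "z \<in> N"
      using fz unfolding I_def J_def by auto
    obtain w where w: "w \<in> N" "w \<in> J" using N by blast
    have wW: "w \<in> W" "f x \<le> f w" "f w \<le> f y" using w unfolding J_def by auto
    have "x \<in> N \<or> y \<in> N"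
      using fz
    proof
      assume "f z < f x"
      then show ?thesis using cf[OF N(1)] N(4) w wW mem inW[of w x] unfolding convex_wrt_def
        by (metis le_neq_implies_less)
    next
      assume "f y < f z"
      then show ?thesis using cf[OF N(1)] N(4) w wW mem inW[of w y] unfolding convex_wrt_def
        by (metis le_neq_implies_less)
    qed
    then have "M \<subseteq> N" using N sxz syz unfolding sep_def by blast
    then show False using N by blast
  qed
  have lamI: "laminar I A" if A: "A \<in> \<B>" for A
  proof -
    consider "A \<inter> M = {}" | "M \<subseteq> A" | "A \<subset> M" using lam[OF A M] unfolding laminar_def by blast
    then show ?thesis
    proof cases
      case 3
      show ?thesis
      proof (cases "A \<inter> J = {}")
        case False
        then have "A \<subseteq> I" unfolding I_def using A 3 by blast
        then show ?thesis unfolding laminar_def by blast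
      next
        case AJ: True
        show ?thesis
        proof (cases "A \<inter> I = {}")
          case False
          then obtain N where N: "N \<in> \<B>" "N \<subset> M" "N \<inter> J \<noteq> {}" "A \<inter> N \<noteq> {}"
            using AJ unfolding I_def by blast
          then have "A \<subseteq> N" using lam[OF A N(1)] AJ unfolding laminar_def by blast
          then have "A \<subseteq> I" unfolding I_def using N by blast
          then show ?thesis unfolding laminar_def by blast
        qed (auto simp: laminar_def)
      qed
    qed (use IM in \<open>auto simp: laminar_def\<close>)
  qed
  have ext: "\<exists>u\<in>J. \<exists>N. N \<subseteq> I \<and> a \<in> N \<and> u \<in> N \<and> convex_wrt W f N" if a: "a \<in> I" for a
  proof (cases "a \<in> J")
    case True
    have "convex_wrt W f {a}" unfolding convex_wrt_def by auto
    then show ?thesis using True a by blast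
  next
    case False
    then obtain N where N: "N \<in> \<B>" "N \<subset> M" "N \<inter> J \<noteq> {}" "a \<in> N" using a unfolding I_def by blast
    then have "N \<subseteq> I" unfolding I_def by blast
    then show ?thesis using N cf by blast
  qed
  have cI: "convex_wrt W f I"
    unfolding convex_wrt_def
  proof (intro ballI impI)
    fix a c b assume a: "a \<in> I" and c: "c \<in> I" and b: "b \<in> W" and l: "f a < f b \<and> f b < f c"
    obtain u N where u: "u \<in> J" "N \<subseteq> I" "a \<in> N" "u \<in> N" "convex_wrt W f N" using ext[OF a] by blast
    obtain v N' where v: "v \<in> J" "N' \<subseteq> I" "c \<in> N'" "v \<in> N'" "convex_wrt W f N'" using ext[OF c] by blast
    show "b \<in> I"
    proof (cases "b \<in> J")
      case True
      then show ?thesis unfolding I_def by blast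
    next
      case False
      then consider "f b < f x" | "f y < f b" using b unfolding J_def by force
      then show ?thesis
      proof cases
        case 1
        then have "f b < f u" using u unfolding J_def by auto
        then have "b \<in> N" using u l b unfolding convex_wrt_def by blast
        then show ?thesis using u by blast
      next
        case 2
        then have "f v < f b" using v unfolding J_def by auto
        then have "b \<in> N'" using v l b unfolding convex_wrt_def by blast
        then show ?thesis using v by blast
      qed
    qed
  qed
  have "x \<in> I" "y \<in> I" "x \<noteq> y" using xyJ sxy unfolding I_def sep_def by auto
  moreover have "I \<subset> W" using IM zI mem BW[OF M] by blast
  ultimately have "convex_wrt W g I" using U[of I] lamI cI by blast
  then show ?thesis using zI \<open>x \<in> I\<close> \<open>y \<in> I\<close> mem(6) unfolding convex_wrt_def by blast
qed

lemma orientation_uniform: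
  fixes f g :: "'a \<Rightarrow> nat"
  assumes injf: "inj_on f W" and injg: "inj_on g W"
    and BW: "\<And>A. A \<in> \<B> \<Longrightarrow> A \<subseteq> W"
    and lam: "\<And>A B. A \<in> \<B> \<Longrightarrow> B \<in> \<B> \<Longrightarrow> laminar A B"
    and cf: "\<And>A. A \<in> \<B> \<Longrightarrow> convex_wrt W f A"
    and cg: "\<And>A. A \<in> \<B> \<Longrightarrow> convex_wrt W g A"
    and U: "\<And>I. I \<subset> W \<Longrightarrow> \<exists>x\<in>I. \<exists>y\<in>I. x \<noteq> y \<Longrightarrow> \<forall>A\<in>\<B>. laminar I A \<Longrightarrow>
        convex_wrt W f I \<Longrightarrow> convex_wrt W g I"
    and M: "M \<in> \<B>" and sxy: "sep \<B> M x y" and suv: "sep \<B> M u v"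
  shows "(f x < f y \<longleftrightarrow> g x < g y) \<longleftrightarrow> (f u < f v \<longleftrightarrow> g u < g v)"
proof -
  define s where "s x y \<longleftrightarrow> (f x < f y \<longleftrightarrow> g x < g y)" for x y
  have ne: "f x \<noteq> f y \<and> g x \<noteq> g y" if "sep \<B> M x y" for x y
  proof -
    have "x \<in> W" "y \<in> W" "x \<noteq> y" using that BW[OF M] unfolding sep_def by auto
    then show ?thesis using inj_on_eq_iff[OF injf] inj_on_eq_iff[OF injg] by simp
  qed
  have s_sym: "s x y = s y x" if "sep \<B> M x y" for x y
    using ne[OF that] unfolding s_def by linarith
  have nb: "\<not> (g x < g z \<and> g z < g y) \<and> \<not> (g y < g z \<and> g z < g x)"
    if "sep \<B> M x y" "sep \<B> M x z" "sep \<B> M y z" "f x < f y" "f z < f x \<or> f y < f z" for x y z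
    using injf BW lam cf U M that by (rule nonbetween_preserved)
  have mid: "(g a < g b \<and> g b < g c) \<or> (g c < g b \<and> g b < g a)"
    if sp: "sep \<B> M a b" "sep \<B> M a c" "sep \<B> M b c" and l: "f a < f b" "f b < f c" for a b c
  proof -
    have "\<not> (g a < g c \<and> g c < g b)" "\<not> (g b < g c \<and> g c < g a)"
      using nb[OF sp l(1)] l by auto
    moreover have "\<not> (g b < g a \<and> g a < g c)" "\<not> (g c < g a \<and> g a < g b)"
      using nb[OF sp(3) sep_commute[OF sp(1)] sep_commute[OF sp(2)] l(2)] l by auto
    ultimately show ?thesis using ne[OF sp(1)] ne[OF sp(2)] ne[OF sp(3)]
      by (metis linorder_neqE_nat)
  qed
  have tri: "s x y = s x z" if sp: "sep \<B> M x y" "sep \<B> M x z" "sep \<B> M y z" for x y z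
  proof -
    note sc = sep_commute[OF sp(1)] sep_commute[OF sp(2)] sep_commute[OF sp(3)]
    consider "f x < f y" "f y < f z" | "f x < f z" "f z < f y" | "f y < f x" "f x < f z"
      | "f y < f z" "f z < f x" | "f z < f x" "f x < f y" | "f z < f y" "f y < f x"
      using ne[OF sp(1)] ne[OF sp(2)] ne[OF sp(3)] by (metis linorder_neqE_nat)
    then show ?thesis
    proof cases
      case 1 then show ?thesis using mid[OF sp] unfolding s_def by auto
    next
      case 2 then show ?thesis using mid[OF sp(2,1) sc(3)] unfolding s_def by auto
    next
      case 3 then show ?thesis using mid[OF sc(1) sp(3,2)] unfolding s_def by auto
    next
      case 4 then show ?thesis using mid[OF sp(3) sc(1,2)] unfolding s_def by auto
    next
      case 5 then show ?thesis using mid[OF sc(2,3) sp(1)] unfolding s_def by auto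
    next
      case 6 then show ?thesis using mid[OF sc(3,2,1)] unfolding s_def by auto
    qed
  qed
  have same: "s x y = s x z" if sp: "sep \<B> M x y" "sep \<B> M x z" and nsp: "\<not> sep \<B> M y z" for x y z
  proof (cases "y = z")
    case False
    then obtain N where N: "N \<in> \<B>" "y \<in> N" "z \<in> N" "\<not> M \<subseteq> N" using nsp sp unfolding sep_def by blast
    then have "x \<notin> N" using sp unfolding sep_def by blast
    moreover have "x \<in> W" using sp BW[OF M] unfolding sep_def by blast
    ultimately have "\<not> (f y < f x \<and> f x < f z)" "\<not> (f z < f x \<and> f x < f y)"
      "\<not> (g y < g x \<and> g x < g z)" "\<not> (g z < g x \<and> g x < g y)"
      using cf[OF N(1)] cg[OF N(1)] N unfolding convex_wrt_def by blast+
    then have "f x < f y \<longleftrightarrow> f x < f z" "g x < g y \<longleftrightarrow> g x < g z"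
      using ne[OF sp(1)] ne[OF sp(2)] by (metis linorder_neqE_nat)+
    then show ?thesis unfolding s_def by simp
  qed simp
  have step: "s x y = s x z" if "sep \<B> M x y" "sep \<B> M x z" for x y z
    using tri same that by blast
  have "s x y = s u v"
  proof (cases "sep \<B> M x u")
    case True
    then show ?thesis using step[OF sxy True] s_sym[OF True] step[OF sep_commute[OF True] suv] by simp
  next
    case False
    show ?thesis
    proof (cases "sep \<B> M x v")
      case True
      then show ?thesis
        using step[OF sxy True] s_sym[OF True] step[OF sep_commute[OF True] sep_commute[OF suv]] s_sym[OF suv]
        by simp
    next
      case xv: False
      have "x \<noteq> u \<or> x \<noteq> v" "u \<in> M" "v \<in> M" "x \<in> M" using suv sxy unfolding sep_def by auto
      show ?thesis
      proof (cases "x = u \<or> x = v")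
        case True
        then show ?thesis using False xv suv sep_commute[OF suv] by blast
      next
        case neq: False
        obtain N where N: "N \<in> \<B>" "x \<in> N" "u \<in> N" "\<not> M \<subseteq> N"
          using False neq \<open>u \<in> M\<close> \<open>x \<in> M\<close> unfolding sep_def by blast
        obtain N' where N': "N' \<in> \<B>" "x \<in> N'" "v \<in> N'" "\<not> M \<subseteq> N'"
          using xv neq \<open>v \<in> M\<close> \<open>x \<in> M\<close> unfolding sep_def by blast
        have "N \<subseteq> N' \<or> N' \<subseteq> N" using lam[OF N(1) N'(1)] N N' unfolding laminar_def by blast
        then show ?thesis using N N' suv unfolding sep_def by blast
      qed
    qed
  qed
  then show ?thesis unfolding s_def .
qed

section \<open>Rooted representatives\<close>


definition pos :: "nat list \<Rightarrow> nat \<Rightarrow> nat" where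
  "pos ys = inv_into {0..<length ys} ((!) ys)"

text \<open>
  The root is placed last because the block of edges cut off by a diagonal \<open>i < j\<close> never contains
  position \<open>n - 1\<close>.
\<close>
definition rooted :: "nat \<Rightarrow> nat list \<Rightarrow> bool" where
  "rooted n ys \<longleftrightarrow> lin_ord n ys \<and> ys ! (n - 1) = 0"

definition blocks :: "nat \<Rightarrow> nat set set set \<Rightarrow> nat set set" where
  "blocks n D = insert {1..<n} {A. 0 \<notin> A \<and> (\<exists>S\<in>D. A \<in> S)}"

definition rev_block :: "nat \<Rightarrow> nat \<Rightarrow> nat list \<Rightarrow> nat list" where
  "rev_block i j ys = take i ys @ rev (take (j - i) (drop i ys)) @ drop j ys"

lemma pos_nth: "lin_ord n ys \<Longrightarrow> p < n \<Longrightarrow> pos ys (ys ! p) = p"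
  unfolding pos_def using lin_ord_inj[of n ys] lin_ord_length[of n ys] by (simp add: inv_into_f_f)

lemma nth_pos:
  assumes "lin_ord n ys" "x < n" shows "pos ys x < n" "ys ! pos ys x = x"
proof -
  have x: "x \<in> (!) ys ` {0..<length ys}"
    using lin_ord_image[OF assms(1)] lin_ord_length[OF assms(1)] assms(2) by simp
  show "pos ys x < n"
    using inv_into_into[OF x] lin_ord_length[OF assms(1)] unfolding pos_def by simp
  show "ys ! pos ys x = x" unfolding pos_def by (rule f_inv_into_f[OF x])
qed

lemma pos_eqI: "lin_ord n ys \<Longrightarrow> p < n \<Longrightarrow> ys ! p = x \<Longrightarrow> pos ys x = p"
  using pos_nth by blast

lemma inj_on_pos:
  assumes "lin_ord n ys" shows "inj_on (pos ys) {0..<n}"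
proof (rule inj_onI)
  fix x y assume "x \<in> {0..<n}" "y \<in> {0..<n}" "pos ys x = pos ys y"
  then show "x = y" using nth_pos(2)[OF assms] by (metis atLeastLessThan_iff)
qed

lemma mem_image_iff_pos:
  "lin_ord n ys \<Longrightarrow> x < n \<Longrightarrow> j \<le> n \<Longrightarrow> x \<in> (!) ys ` {i..<j} \<longleftrightarrow> i \<le> pos ys x \<and> pos ys x < j"
  using lin_ord_nth_mem_image_iff[of n ys "pos ys x" j i] nth_pos[of n ys x] by simp

lemma convex_wrt_image:
  assumes "lin_ord n ys" "j \<le> n"
  shows "convex_wrt {1..<n} (pos ys) ((!) ys ` {i..<j})"
  unfolding convex_wrt_def
proof (intro ballI impI)
  fix a c b assume "a \<in> (!) ys ` {i..<j}" "c \<in> (!) ys ` {i..<j}" "b \<in> {1..<n}"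
    and l: "pos ys a < pos ys b \<and> pos ys b < pos ys c"
  moreover from this have "a < n" "c < n" using lin_ord_image_subset[OF assms, of i] by auto
  ultimately show "b \<in> (!) ys ` {i..<j}"
    using mem_image_iff_pos[OF assms(1) _ assms(2), of _ i] by auto
qed

lemma rooted_root_part:
  assumes r: "rooted n ys" and S: "S \<in> diags n ys" and A: "A \<in> S" "0 \<notin> A"
  obtains i j where "is_diag n i j" "A = (!) ys ` {i..<j}" "S = {A, {0..<n} - A}"
proof -
  have lin: "lin_ord n ys" and l0: "ys ! (n - 1) = 0" using r unfolding rooted_def by auto
  obtain i j where ij: "is_diag n i j" and S': "S = {(!) ys ` {i..<j}, {0..<n} - (!) ys ` {i..<j}}"
    using S lin by (rule diagsE)
  have "ys ! (n - 1) \<in> {0..<n} - (!) ys ` {i..<j}"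
    using ij lin_ord_nth_mem_image_iff[OF lin, of "n - 1" j i] lin_ord_nth_less[OF lin, of "n - 1"]
    unfolding is_diag_def by auto
  then have "A = (!) ys ` {i..<j}" using A S' l0 by auto
  then show thesis using that[OF ij] S' by simp
qed

lemma convex_imp_diag:
  assumes r: "rooted n ys" and I: "I \<subset> {1..<n}" "\<exists>x\<in>I. \<exists>y\<in>I. x \<noteq> y"
    and c: "convex_wrt {1..<n} (pos ys) I"
  shows "{I, {0..<n} - I} \<in> diags n ys"
proof -
  have lin: "lin_ord n ys" and l0: "ys ! (n - 1) = 0" using r unfolding rooted_def by auto
  have IW: "x < n" "0 < x" if "x \<in> I" for x using that I by auto
  have fin: "finite (pos ys ` I)" using I finite_subset by (metis finite_atLeastLessThan finite_imageI psubset_imp_subset)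
  have ne: "pos ys ` I \<noteq> {}" using I by blast
  define i where "i = Min (pos ys ` I)"
  define m where "m = Max (pos ys ` I)"
  obtain a where a: "a \<in> I" "pos ys a = i" using Min_in[OF fin ne] unfolding i_def by auto
  obtain b where b: "b \<in> I" "pos ys b = m" using Max_in[OF fin ne] unfolding m_def by auto
  have bd: "i \<le> pos ys x \<and> pos ys x \<le> m" if "x \<in> I" for x
    using that fin unfolding i_def m_def by auto
  have mn: "m < n" using nth_pos(1)[OF lin IW(1)[OF b(1)]] b by simp
  have "m \<noteq> n - 1" using nth_pos(2)[OF lin IW(1)[OF b(1)]] b l0 IW(2)[OF b(1)] by auto
  then have mn1: "m + 1 < n" using mn by linarith
  have Ieq: "I = (!) ys ` {i..<m + 1}"
  proof (intro equalityI subsetI)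
    fix x assume x: "x \<in> I"
    then show "x \<in> (!) ys ` {i..<m + 1}"
      using mem_image_iff_pos[OF lin IW(1)[OF x], of "m + 1" i] bd[OF x] mn1 by auto
  next
    fix x assume "x \<in> (!) ys ` {i..<m + 1}"
    then obtain p where p: "x = ys ! p" "i \<le> p" "p \<le> m" by auto
    have px: "pos ys x = p" "x < n" using pos_nth[OF lin, of p] lin_ord_nth_less[OF lin, of p] p mn by auto
    have "p \<noteq> n - 1" using p mn1 by simp
    then have "x \<noteq> 0" using p l0 lin_ord_nth_eq_iff[OF lin, of p "n - 1"] mn by auto
    then have xW: "x \<in> {1..<n}" using px by simp
    consider "p = i" | "p = m" | "i < p" "p < m" using p by linarith
    then show "x \<in> I"
    proof cases
      case 1
      then have "x = a" using a nth_pos(2)[OF lin IW(1)[OF a(1)]] p by simp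
      then show ?thesis using a by simp
    next
      case 2
      then have "x = b" using b nth_pos(2)[OF lin IW(1)[OF b(1)]] p by simp
      then show ?thesis using b by simp
    next
      case 3
      then have "pos ys a < pos ys x \<and> pos ys x < pos ys b" using a b px by simp
      then show ?thesis using c a(1) b(1) xW unfolding convex_wrt_def by blast
    qed
  qed
  have "is_diag n i (m + 1)"
  proof -
    obtain x y where xy: "x \<in> I" "y \<in> I" "x \<noteq> y" using I by blast
    have "pos ys x \<noteq> pos ys y" using xy IW inj_on_pos[OF lin] by (auto simp: inj_on_def)
    then have "i < m" using bd[OF xy(1)] bd[OF xy(2)] by linarith
    moreover have "\<not> (i = 0 \<and> m + 1 = n - 1)"
    proof
      assume im: "i = 0 \<and> m + 1 = n - 1"
      have "x \<in> I" if x: "x \<in> {1..<n}" for x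
      proof -
        have "pos ys x \<noteq> n - 1" using nth_pos(2)[OF lin, of x] x l0 by auto
        then have "pos ys x < n - 1" using nth_pos(1)[OF lin, of x] x by auto
        then show ?thesis using im Ieq mem_image_iff_pos[OF lin, of x "m + 1" i] x by auto
      qed
      then show False using I by blast
    qed
    ultimately show ?thesis using mn1 unfolding is_diag_def by linarith
  qed
  then show ?thesis using diagsI[OF lin _ Ieq] by blast
qed

lemma nth_rev_block:
  assumes "i \<le> j" "j \<le> length ys" "p < length ys"
  shows "rev_block i j ys ! p = (if i \<le> p \<and> p < j then ys ! (i + j - Suc p) else ys ! p)"
proof -
  have [simp]: "length (take (j - i) (drop i ys)) = j - i" "length (take i ys) = i" using assms by auto
  consider "p < i" | "i \<le> p" "p < j" | "j \<le> p" by linarith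
  then show ?thesis
  proof cases
    case 1
    then show ?thesis unfolding rev_block_def using assms by (simp add: nth_append)
  next
    case 2
    have "rev_block i j ys ! p = rev (take (j - i) (drop i ys)) ! (p - i)"
      unfolding rev_block_def using 2 assms by (simp add: nth_append)
    also have "\<dots> = take (j - i) (drop i ys) ! (j - i - Suc (p - i))"
      using 2 assms by (subst rev_nth) auto
    also have "\<dots> = ys ! (i + (j - i - Suc (p - i)))" using 2 assms by (subst nth_take) auto
    also have "i + (j - i - Suc (p - i)) = i + j - Suc p" using 2 by linarith
    finally show ?thesis using 2 by simp
  next
    case 3
    then have "p - i - (j - i) = p - j" "i \<le> p" "j - i \<le> p - i" using assms by auto
    then show ?thesis unfolding rev_block_def using 3 assms by (simp add: nth_append)
  qed
qed

lemma lin_ord_rev_block: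
  assumes "lin_ord n ys" "i \<le> j" shows "lin_ord n (rev_block i j ys)"
proof -
  have dec: "ys = take i ys @ take (j - i) (drop i ys) @ drop j ys"
    using assms by (metis append_take_drop_id drop_drop le_add_diff_inverse2)
  have s: "set (rev_block i j ys) = set (take i ys @ take (j - i) (drop i ys) @ drop j ys)"
    and d: "distinct (rev_block i j ys) = distinct (take i ys @ take (j - i) (drop i ys) @ drop j ys)"
    unfolding rev_block_def distinct_append set_append by simp_all
  show ?thesis using assms(1) unfolding lin_ord_def s d dec[symmetric] .
qed

lemma pos_rev_block:
  assumes lin: "lin_ord n ys" and ij: "i \<le> j" "j \<le> n" and x: "x < n"
  shows "pos (rev_block i j ys) x =
    (if i \<le> pos ys x \<and> pos ys x < j then i + j - Suc (pos ys x) else pos ys x)"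
proof -
  have p: "pos ys x < n" "ys ! pos ys x = x" using nth_pos[OF lin x] .
  have len: "length ys = n" using lin_ord_length[OF lin] .
  show ?thesis
    by (rule pos_eqI[OF lin_ord_rev_block[OF lin ij(1)]])
      (use p ij len nth_rev_block[of i j ys] in auto)
qed

lemma twist_step_rev_block:
  assumes lin: "lin_ord n ys" and ij: "is_diag n i j" and A: "A = (!) ys ` {i..<j}"
  shows "twist_step n (circ_ord n ys) {A, {0..<n} - A} (circ_ord n (rev_block i j ys))"
proof -
  let ?us = "rotate i ys"
  have d: "i < j" "j < n" using ij unfolding is_diag_def by auto
  have len: "length ys = n" using lin_ord_length[OF lin] .
  have us: "?us = drop i ys @ take i ys" using rotate_drop_take[of i ys] len d by simp
  have t: "take (j - i) ?us = take (j - i) (drop i ys)" unfolding us using len d by simp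
  have dr: "drop (j - i) ?us = drop j ys @ take i ys" unfolding us using len d by simp
  have z: "rev (take (j - i) ?us) @ drop (j - i) ?us = rotate i (rev_block i j ys)"
    unfolding t dr rev_block_def using rotate_append[of "take i ys" "rev (take (j - i) (drop i ys)) @ drop j ys"] len d
    by simp
  have linz: "lin_ord n (rev_block i j ys)" using lin_ord_rev_block[OF lin] d by simp
  have "set (take (j - i) ?us) = A" unfolding t A using set_take_drop_eq_image[of j ys i] len d by simp
  moreover have "set (drop (j - i) ?us) = {0..<n} - set (take (j - i) ?us)"
  proof -
    have "distinct ?us" "set ?us = {0..<n}" using lin unfolding lin_ord_def by auto
    moreover have "set (take (j - i) ?us) \<union> set (drop (j - i) ?us) = set ?us"
      by (metis append_take_drop_id set_append)
    moreover have "set (take (j - i) ?us) \<inter> set (drop (j - i) ?us) = {}"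
      using \<open>distinct ?us\<close> set_take_disj_set_drop_if_distinct[of ?us "j - i" "j - i"] by simp
    ultimately show ?thesis by blast
  qed
  ultimately have "{A, {0..<n} - A} = {set (take (j - i) ?us), set (drop (j - i) ?us)}" by simp
  moreover have "circ_ord n (rev_block i j ys) = circ_ord n (rev (take (j - i) ?us) @ drop (j - i) ?us)"
    unfolding z using circ_ord_eq[OF rotate_in_circ_ord[OF linz] linz] by simp
  moreover have "?us \<in> circ_ord n ys" using rotate_in_circ_ord[OF lin] .
  ultimately show ?thesis unfolding twist_step_def using d
    by (intro bexI[of _ ?us] exI[of _ "j - i"]) auto
qed

lemma circ_ord_rev_block_all:
  assumes lin: "lin_ord n ys" and n: "0 < n"
  shows "circ_ord n (rev_block 0 (n - 1) ys) = circ_ord n ys"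
proof -
  have len: "length ys = n" using lin_ord_length[OF lin] .
  then have "ys = take (n - 1) ys @ [ys ! (n - 1)]"
    using n by (metis Suc_pred' lessI take_Suc_conv_app_nth take_all order_refl)
  then have "rotate1 (rev ys) = rev (take (n - 1) ys) @ [ys ! (n - 1)]"
    by (metis rev.simps(2) rev_append rev_rev_ident rotate1.simps(2) append_Cons append_Nil rev_singleton_conv)
  moreover have "drop (n - 1) ys = [ys ! (n - 1)]"
    using len n Cons_nth_drop_Suc[of "n - 1" ys] by simp
  ultimately have "rev_block 0 (n - 1) ys = rotate 1 (rev ys)" unfolding rev_block_def by simp
  moreover have "rotate 1 (rev ys) \<in> circ_ord n ys"
    using lin lin_ord_rev lin_ord_rotate unfolding circ_ord_def by blast
  ultimately show ?thesis using circ_ord_eq[OF _ lin] by simp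
qed

lemma blocks_image:
  assumes n: "4 \<le> n" and r: "rooted n ys" and D: "noncrossing n (circ_ord n ys) D" and M: "M \<in> blocks n D"
  obtains i j where "i < j" "j < n" "M = (!) ys ` {i..<j}" "twists n D (circ_ord n ys) (circ_ord n (rev_block i j ys))"
proof -
  have lin: "lin_ord n ys" and l0: "ys ! (n - 1) = 0" using r unfolding rooted_def by auto
  consider "M = {1..<n}" | S where "S \<in> D" "M \<in> S" "0 \<notin> M" using M unfolding blocks_def by blast
  then show thesis
  proof cases
    case 1
    have "(!) ys ` {0..<n - 1} = {0..<n} - (!) ys ` {n - 1..<n}"
      using lin_ord_compl_prefix[OF lin, of "n - 1"] lin_ord_image_subset[OF lin, of "n - 1" 0] by auto
    also have "{n - 1..<n} = {n - 1}" using n by auto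
    finally have "M = (!) ys ` {0..<n - 1}" using 1 l0 by auto
    moreover have "twists n D (circ_ord n ys) (circ_ord n (rev_block 0 (n - 1) ys))"
      unfolding twists_def using circ_ord_rev_block_all[OF lin] n by simp
    ultimately show thesis using that[of 0 "n - 1"] n by simp
  next
    case 2
    have "S \<in> diags n ys" using D 2 noncrossing_iff[OF circ_ord_in[OF lin] circ_ord_refl[OF lin]] by blast
    then obtain i j where ij: "is_diag n i j" "M = (!) ys ` {i..<j}" "S = {M, {0..<n} - M}"
      using rooted_root_part[OF r _ 2(2,3)] by blast
    have "twists n D (circ_ord n ys) (circ_ord n (rev_block i j ys))"
      unfolding twists_def using twist_step_rev_block[OF lin ij(1,2)] ij(3) 2(1) by blast
    then show thesis using that[OF _ _ ij(2)] ij(1) unfolding is_diag_def by blast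
  qed
qed

lemma flip_block:
  assumes n: "4 \<le> n" and r: "rooted n ys" and D: "noncrossing n (circ_ord n ys) D" and M: "M \<in> blocks n D"
  obtains us where "rooted n us" "twists n D (circ_ord n ys) (circ_ord n us)"
    "\<And>x y. x \<in> M \<Longrightarrow> y \<in> M \<Longrightarrow> x \<noteq> y \<Longrightarrow> pos us x < pos us y \<longleftrightarrow> \<not> pos ys x < pos ys y"
    "\<And>x y. x < n \<Longrightarrow> y < n \<Longrightarrow> \<not> (x \<in> M \<and> y \<in> M) \<Longrightarrow> pos us x < pos us y \<longleftrightarrow> pos ys x < pos ys y"
proof -
  have lin: "lin_ord n ys" and l0: "ys ! (n - 1) = 0" using r unfolding rooted_def by auto
  obtain i j where ij: "i < j" "j < n" "M = (!) ys ` {i..<j}"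
    and tw: "twists n D (circ_ord n ys) (circ_ord n (rev_block i j ys))"
    using blocks_image[OF n r D M] by blast
  let ?us = "rev_block i j ys"
  have "rooted n ?us"
    using lin_ord_rev_block[OF lin, of i j] ij l0 nth_rev_block[of i j ys "n - 1"] lin_ord_length[OF lin]
    unfolding rooted_def by auto
  moreover have Mi: "x \<in> M \<longleftrightarrow> i \<le> pos ys x \<and> pos ys x < j" if "x < n" for x
    using mem_image_iff_pos[OF lin that, of j i] ij by simp
  have Mn: "x < n" if "x \<in> M" for x using that lin_ord_image_subset[OF lin, of j i] ij by auto
  have P: "pos ?us x = (if x \<in> M then i + j - Suc (pos ys x) else pos ys x)" if "x < n" for x
    using pos_rev_block[OF lin _ _ that, of i j] ij Mi[OF that] by simp
  have "pos ?us x < pos ?us y \<longleftrightarrow> \<not> pos ys x < pos ys y" if "x \<in> M" "y \<in> M" "x \<noteq> y" for x y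
  proof -
    have "pos ys x \<noteq> pos ys y" using that Mn inj_on_pos[OF lin] by (auto simp: inj_on_def)
    then show ?thesis using P[OF Mn[OF that(1)]] P[OF Mn[OF that(2)]] Mi[OF Mn[OF that(1)]] Mi[OF Mn[OF that(2)]] that(1,2)
      by auto
  qed
  moreover have "pos ?us x < pos ?us y \<longleftrightarrow> pos ys x < pos ys y"
    if "x < n" "y < n" "\<not> (x \<in> M \<and> y \<in> M)" for x y
    using P[OF that(1)] P[OF that(2)] Mi[OF that(1)] Mi[OF that(2)] that(3) by auto
  ultimately show thesis using that[of ?us] tw by blast
qed

lemma rooted_ex:
  assumes n: "0 < n" and pi: "\<pi> \<in> circ_orderings n"
  obtains ys where "rooted n ys" "\<pi> = circ_ord n ys"
proof -
  obtain us where us: "us \<in> \<pi>" using circ_orderings_nonempty[OF pi] by blast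
  have lin: "lin_ord n us" "\<pi> = circ_ord n us" using circ_orderingsE[OF pi us] by auto
  have len: "length us = n" using lin_ord_length[OF lin(1)] .
  let ?ys = "rotate (pos us 0 + 1) us"
  have ys: "?ys \<in> \<pi>" unfolding lin(2) by (rule rotate_in_circ_ord[OF lin(1)])
  have p: "pos us 0 < n" "us ! pos us 0 = 0" using nth_pos[OF lin(1), of 0] n by auto
  have "?ys ! (n - 1) = us ! ((pos us 0 + 1 + (n - 1)) mod n)" using n len by (subst nth_rotate) auto
  also have "(pos us 0 + 1 + (n - 1)) mod n = pos us 0" using n p by simp
  finally have "rooted n ?ys" using p circ_orderingsE[OF pi ys] unfolding rooted_def by simp
  then show thesis using that circ_orderingsE[OF pi ys] by blast
qed

lemma eq_of_same_order:
  assumes ys: "lin_ord n ys" and zs: "lin_ord n zs"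
    and o: "\<And>x y. x < n \<Longrightarrow> y < n \<Longrightarrow> pos ys x < pos ys y \<longleftrightarrow> pos zs x < pos zs y"
  shows "ys = zs"
proof -
  have c: "pos us x = card {y. y < n \<and> pos us y < pos us x}" if us: "lin_ord n us" and x: "x < n" for us x
  proof -
    have "{y. y < n \<and> pos us y < pos us x} = (!) us ` {0..<pos us x}"
    proof (intro set_eqI)
      fix y
      have "y < n" if "y \<in> (!) us ` {0..<pos us x}"
        using that lin_ord_image_subset[OF us, of "pos us x" 0] nth_pos(1)[OF us x] by auto
      then show "y \<in> {y. y < n \<and> pos us y < pos us x} \<longleftrightarrow> y \<in> (!) us ` {0..<pos us x}"
        using mem_image_iff_pos[OF us, of y "pos us x" 0] nth_pos(1)[OF us x] by auto
    qed
    moreover have "inj_on ((!) us) {0..<pos us x}"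
      using lin_ord_inj[OF us] nth_pos(1)[OF us x] by (auto intro: inj_on_subset)
    ultimately show ?thesis by (simp add: card_image)
  qed
  have p: "pos ys x = pos zs x" if "x < n" for x
  proof -
    have "{y. y < n \<and> pos ys y < pos ys x} = {y. y < n \<and> pos zs y < pos zs x}" using o that by auto
    then show ?thesis using c[OF ys that] c[OF zs that] by simp
  qed
  show ?thesis
  proof (rule nth_equalityI)
    show "length ys = length zs" using lin_ord_length ys zs by simp
    fix k assume "k < length ys"
    then have k: "k < n" using lin_ord_length[OF ys] by simp
    then have "ys ! k < n" using lin_ord_nth_less[OF ys] by simp
    then show "ys ! k = zs ! k" using p[of "ys ! k"] pos_nth[OF ys k] nth_pos(2)[OF zs] by metis
  qed
qed

section \<open>Connectedness under twists\<close>


lemma noncrossing_diags: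
  assumes "lin_ord n ys" "noncrossing n (circ_ord n ys) D" "S \<in> D"
  shows "S \<in> diags n ys"
  using assms(2,3) noncrossing_iff[OF circ_ord_in[OF assms(1)] circ_ord_refl[OF assms(1)], of D] by auto

lemma compat_imp_laminar:
  assumes "compat {A, X - A} {B, X - B}" "A \<subseteq> X" "B \<subseteq> X" "r \<in> X" "r \<notin> A" "r \<notin> B"
  shows "laminar A B"
proof -
  have "(X - A) \<inter> (X - B) \<noteq> {}" using assms(4-6) by blast
  then have "A \<inter> B = {} \<or> A \<inter> (X - B) = {} \<or> (X - A) \<inter> B = {}"
    using assms(1) unfolding compat_def by simp
  then show ?thesis using assms(2,3) unfolding laminar_def by blast
qed

lemma laminar_imp_compat:
  assumes "laminar A B" shows "compat {A, X - A} {B, X - B}"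
proof -
  have "A \<inter> B = {} \<or> A \<inter> (X - B) = {} \<or> (X - A) \<inter> B = {}"
    using assms unfolding laminar_def by blast
  then show ?thesis unfolding compat_def by blast
qed

lemma compat_commute: "compat S S' \<Longrightarrow> compat S' S"
  unfolding compat_def by blast

lemma blocks_props:
  assumes n: "4 \<le> n" and r: "rooted n ys" and D: "noncrossing n (circ_ord n ys) D"
  shows "A \<in> blocks n D \<Longrightarrow> A \<subseteq> {1..<n}"
    and "A \<in> blocks n D \<Longrightarrow> B \<in> blocks n D \<Longrightarrow> laminar A B"
    and "A \<in> blocks n D \<Longrightarrow> convex_wrt {1..<n} (pos ys) A"
proof -
  have lin: "lin_ord n ys" using r unfolding rooted_def by auto
  have sub: "A \<subseteq> {1..<n}" if A: "A \<in> blocks n D" for A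
  proof -
    obtain i j where "i < j" "j < n" "A = (!) ys ` {i..<j}" by (rule blocks_image[OF n r D A]) (rule that)
    then have "A \<subseteq> {0..<n}" using lin_ord_image_subset[OF lin, of j i] by simp
    moreover have "0 \<notin> A" using A unfolding blocks_def by auto
    moreover have "{0..<n} - {0} = {1..<n}" by auto
    ultimately show ?thesis by blast
  qed
  show "A \<in> blocks n D \<Longrightarrow> A \<subseteq> {1..<n}" by (rule sub)
  show "convex_wrt {1..<n} (pos ys) A" if A: "A \<in> blocks n D"
  proof -
    obtain i j where "i < j" "j < n" "A = (!) ys ` {i..<j}" by (rule blocks_image[OF n r D A]) (rule that)
    then show ?thesis using convex_wrt_image[OF lin, of j i] by simp
  qed
  have split: "\<exists>S\<in>D. S = {A, {0..<n} - A}" if A: "A \<in> blocks n D" "A \<noteq> {1..<n}" for A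
  proof -
    obtain S where S: "S \<in> D" "A \<in> S" "0 \<notin> A" using A unfolding blocks_def by blast
    have "S \<in> diags n ys" using noncrossing_diags[OF lin D S(1)] .
    then have "S = {A, {0..<n} - A}" using rooted_root_part[OF r _ S(2,3)] by blast
    then show ?thesis using S by blast
  qed
  show "laminar A B" if A: "A \<in> blocks n D" and B: "B \<in> blocks n D"
  proof (cases "A = {1..<n} \<or> B = {1..<n}")
    case True
    then show ?thesis using sub[OF A] sub[OF B] unfolding laminar_def by blast
  next
    case False
    then obtain S S' where S: "S \<in> D" "S = {A, {0..<n} - A}" "S' \<in> D" "S' = {B, {0..<n} - B}"
      using split A B by blast
    have "compat {A, {0..<n} - A} {B, {0..<n} - B}"
      using noncrossing_compat[OF circ_ord_in[OF lin] D S(1,3)] S(2,4) by simp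
    then show ?thesis using sub[OF A] sub[OF B] n by (intro compat_imp_laminar[of A "{0..<n}" B 0]) auto
  qed
qed

lemma convex_transfer:
  assumes n: "4 \<le> n" and ry: "rooted n ys" and rz: "rooted n zs"
    and D: "noncrossing n (circ_ord n zs) D"
    and U: "\<And>S. noncrossing n (circ_ord n zs) (insert S D) \<Longrightarrow> noncrossing n (circ_ord n ys) (insert S D)"
    and I: "I \<subset> {1..<n}" "\<exists>x\<in>I. \<exists>y\<in>I. x \<noteq> y" "\<forall>A\<in>blocks n D. laminar I A"
    and c: "convex_wrt {1..<n} (pos zs) I"
  shows "convex_wrt {1..<n} (pos ys) I"
proof -
  have ly: "lin_ord n ys" and lz: "lin_ord n zs" using ry rz unfolding rooted_def by auto
  note iffz = noncrossing_iff[OF circ_ord_in[OF lz] circ_ord_refl[OF lz]]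
  let ?S = "{I, {0..<n} - I}"
  have Sz: "?S \<in> diags n zs" using convex_imp_diag[OF rz I(1,2) c] .
  have comp: "compat ?S S" if S: "S \<in> D" for S
  proof -
    have Sd: "S \<in> diags n zs" using noncrossing_diags[OF lz D S] .
    then obtain A where A: "A \<in> S" "0 \<notin> A" using diagsE[OF Sd lz] by (metis DiffE insertI1 insertI2)
    then have "A \<in> blocks n D" using S unfolding blocks_def by blast
    moreover have "S = {A, {0..<n} - A}" using rooted_root_part[OF rz Sd A] by blast
    ultimately show ?thesis using laminar_imp_compat[of I A "{0..<n}"] I(3) by simp
  qed
  have "compat ?S ?S" using laminar_imp_compat[of I I] unfolding laminar_def by blast
  then have "\<forall>S\<in>insert ?S D. \<forall>S'\<in>insert ?S D. compat S S'"
    using comp compat_commute noncrossing_compat[OF circ_ord_in[OF lz] D] by blast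
  then have "noncrossing n (circ_ord n zs) (insert ?S D)"
    using iffz[of "insert ?S D"] iffz[of D] D Sz by simp
  then have Sy: "?S \<in> diags n ys"
    using noncrossing_diags[OF ly U] by blast
  have "0 \<notin> I" using I(1) by auto
  obtain i j where "is_diag n i j" "I = (!) ys ` {i..<j}"
    by (rule rooted_root_part[OF ry Sy _ \<open>0 \<notin> I\<close>]) (simp, rule that)
  then show ?thesis using convex_wrt_image[OF ly, of j i] unfolding is_diag_def by simp
qed

lemma align_blocks:
  assumes n: "4 \<le> n" and ry: "rooted n ys" and Dy: "noncrossing n (circ_ord n ys) D"
    and pi: "\<pi> \<in> circ_orderings n" and D: "noncrossing n \<pi> D"
    and U: "\<And>S. noncrossing n \<pi> (insert S D) \<Longrightarrow> noncrossing n (circ_ord n ys) (insert S D)"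
    and E: "E \<subseteq> blocks n D" "\<And>A B. A \<in> E \<Longrightarrow> B \<in> blocks n D \<Longrightarrow> A \<subseteq> B \<Longrightarrow> B \<in> E"
  shows "\<exists>zs. rooted n zs \<and> twists n D \<pi> (circ_ord n zs) \<and>
    (\<forall>M\<in>E. \<forall>x y. sep (blocks n D) M x y \<longrightarrow> (pos zs x < pos zs y \<longleftrightarrow> pos ys x < pos ys y))"
  using E
proof (induction "card E" arbitrary: E)
  case 0
  have "finite (blocks n D)"
    by (rule finite_subset[of _ "Pow {1..<n}"]) (use blocks_props(1)[OF n ry Dy] in auto)
  then have "finite E" using finite_subset "0.prems"(1) by blast
  then have "E = {}" using "0.hyps" by simp
  moreover obtain zs where "rooted n zs" "\<pi> = circ_ord n zs" using rooted_ex[of n] pi n by auto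
  moreover from this have "twists n D \<pi> (circ_ord n zs)" unfolding twists_def by simp
  ultimately show ?case by blast
next
  case (Suc k)
  let ?B = "blocks n D"
  have finE: "finite E" using Suc.hyps(2) card.infinite by fastforce
  have "E \<noteq> {}" using Suc.hyps(2) by auto
  then obtain M where M: "M \<in> E" "\<And>A. A \<in> E \<Longrightarrow> A \<subseteq> M \<Longrightarrow> A = M"
    using finite_has_minimal[OF finE] by metis
  have MB: "M \<in> ?B" using M Suc.prems by blast
  have "k = card (E - {M})" using Suc.hyps(2) M finE by simp
  moreover have "E - {M} \<subseteq> ?B" using Suc.prems by blast
  moreover have "B \<in> E - {M}" if "A \<in> E - {M}" "B \<in> ?B" "A \<subseteq> B" for A B
    using that Suc.prems(2)[of A B] M(2)[of A] by blast
  ultimately obtain zs where rz: "rooted n zs" and tw: "twists n D \<pi> (circ_ord n zs)"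
    and ag: "\<And>N x y. N \<in> E - {M} \<Longrightarrow> sep ?B N x y \<Longrightarrow> (pos zs x < pos zs y \<longleftrightarrow> pos ys x < pos ys y)"
    using Suc.hyps(1)[of "E - {M}"] by blast
  have ly: "lin_ord n ys" and lz: "lin_ord n zs" using ry rz unfolding rooted_def by auto
  have tn: "noncrossing n \<pi> T = noncrossing n (circ_ord n zs) T" if "D \<subseteq> T" for T
    using twists_noncrossing[OF tw pi D] that by blast
  have Dz: "noncrossing n (circ_ord n zs) D" using tn D by blast
  have Uz: "noncrossing n (circ_ord n ys) (insert S D)" if "noncrossing n (circ_ord n zs) (insert S D)" for S
    using that tn[of "insert S D"] U by blast
  have Wn: "{1..<n} \<subseteq> {0..<n}" by auto
  have uni: "(pos zs x < pos zs y \<longleftrightarrow> pos ys x < pos ys y) \<longleftrightarrow> (pos zs u < pos zs v \<longleftrightarrow> pos ys u < pos ys v)"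
    if s: "sep ?B M x y" "sep ?B M u v" for x y u v
  proof (rule orientation_uniform[OF _ _ _ _ _ _ _ MB s, where W = "{1..<n}"])
    show "inj_on (pos zs) {1..<n}" using inj_on_subset[OF inj_on_pos[OF lz] Wn] .
    show "inj_on (pos ys) {1..<n}" using inj_on_subset[OF inj_on_pos[OF ly] Wn] .
    show "\<And>A. A \<in> ?B \<Longrightarrow> A \<subseteq> {1..<n}" using blocks_props(1)[OF n rz Dz] .
    show "\<And>A B. A \<in> ?B \<Longrightarrow> B \<in> ?B \<Longrightarrow> laminar A B" using blocks_props(2)[OF n rz Dz] .
    show "\<And>A. A \<in> ?B \<Longrightarrow> convex_wrt {1..<n} (pos zs) A" using blocks_props(3)[OF n rz Dz] .
    show "\<And>A. A \<in> ?B \<Longrightarrow> convex_wrt {1..<n} (pos ys) A" using blocks_props(3)[OF n ry Dy] .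
    show "convex_wrt {1..<n} (pos ys) I"
      if "I \<subset> {1..<n}" "\<exists>x\<in>I. \<exists>y\<in>I. x \<noteq> y" "\<forall>A\<in>?B. laminar I A" "convex_wrt {1..<n} (pos zs) I" for I
      using convex_transfer[OF n ry rz Dz Uz that] .
  qed
  show ?case
  proof (cases "\<forall>x y. sep ?B M x y \<longrightarrow> (pos zs x < pos zs y \<longleftrightarrow> pos ys x < pos ys y)")
    case True
    then have "\<forall>N\<in>E. \<forall>x y. sep ?B N x y \<longrightarrow> (pos zs x < pos zs y \<longleftrightarrow> pos ys x < pos ys y)"
      using ag by blast
    then show ?thesis using rz tw by blast
  next
    case False
    then have dis: "(pos zs x < pos zs y) \<noteq> (pos ys x < pos ys y)" if "sep ?B M x y" for x y
      using uni that by blast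
    obtain us where us: "rooted n us" "twists n D (circ_ord n zs) (circ_ord n us)"
      and inM: "\<And>x y. x \<in> M \<Longrightarrow> y \<in> M \<Longrightarrow> x \<noteq> y \<Longrightarrow> pos us x < pos us y \<longleftrightarrow> \<not> pos zs x < pos zs y"
      and notM: "\<And>x y. x < n \<Longrightarrow> y < n \<Longrightarrow> \<not> (x \<in> M \<and> y \<in> M) \<Longrightarrow>
        pos us x < pos us y \<longleftrightarrow> pos zs x < pos zs y"
      using flip_block[OF n rz Dz MB] by blast
    have "pos us x < pos us y \<longleftrightarrow> pos ys x < pos ys y" if N: "N \<in> E" and s: "sep ?B N x y" for N x y
    proof (cases "N = M")
      case True
      then show ?thesis using dis[of x y] inM[of x y] s unfolding sep_def by blast
    next
      case False
      have "\<not> (x \<in> M \<and> y \<in> M)"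
      proof
        assume "x \<in> M \<and> y \<in> M"
        then have "N \<subseteq> M" using s MB unfolding sep_def by blast
        then show False using M(2) N False by blast
      qed
      moreover have "x < n" "y < n"
      proof -
        have "N \<subseteq> {1..<n}" using N Suc.prems(1) blocks_props(1)[OF n ry Dy, of N] by auto
        moreover have "x \<in> N" "y \<in> N" using s unfolding sep_def by auto
        ultimately show "x < n" "y < n" by auto
      qed
      ultimately show ?thesis using notM[of x y] ag[of N x y] N False s by simp
    qed
    moreover have "twists n D \<pi> (circ_ord n us)"
      using tw us(2) unfolding twists_def by (rule rtranclp_trans)
    ultimately show ?thesis using us(1) by blast
  qed
qed

lemma twists_connected:
  assumes n: "4 \<le> n" and pi: "\<pi> \<in> circ_orderings n" and pi': "\<pi>' \<in> circ_orderings n"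
    and D: "noncrossing n \<pi> D" and D': "noncrossing n \<pi>' D"
    and U: "\<And>S. noncrossing n \<pi> (insert S D) \<Longrightarrow> noncrossing n \<pi>' (insert S D)"
  shows "twists n D \<pi> \<pi>'"
proof -
  let ?B = "blocks n D"
  obtain ys where ry: "rooted n ys" and ys: "\<pi>' = circ_ord n ys" using rooted_ex[of n] pi' n by auto
  have Dy: "noncrossing n (circ_ord n ys) D" using D' ys by simp
  obtain zs where rz: "rooted n zs" and tw: "twists n D \<pi> (circ_ord n zs)"
    and ag: "\<And>M x y. M \<in> ?B \<Longrightarrow> sep ?B M x y \<Longrightarrow> (pos zs x < pos zs y \<longleftrightarrow> pos ys x < pos ys y)"
    using align_blocks[OF n ry Dy pi D, of ?B] U ys by blast
  have ly: "lin_ord n ys" "ys ! (n - 1) = 0" and lz: "lin_ord n zs" "zs ! (n - 1) = 0"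
    using ry rz unfolding rooted_def by auto
  have "zs = ys"
  proof (rule eq_of_same_order[OF lz(1) ly(1)])
    fix x y assume xy: "x < n" "y < n"
    have p0: "pos zs 0 = n - 1" "pos ys 0 = n - 1"
      using pos_eqI[OF lz(1) _ lz(2)] pos_eqI[OF ly(1) _ ly(2)] n by auto
    have lt: "pos us a < n - 1" if "rooted n us" "a < n" "a \<noteq> 0" for us a
    proof -
      have "lin_ord n us" "us ! (n - 1) = 0" using that(1) unfolding rooted_def by auto
      then have "pos us a \<noteq> n - 1" "pos us a < n" using nth_pos[of n us a] that by auto
      then show ?thesis by linarith
    qed
    consider "x = y" | "x = 0" "y \<noteq> 0" | "x \<noteq> 0" "y = 0" | "x \<noteq> 0" "y \<noteq> 0" "x \<noteq> y" by auto
    then show "pos zs x < pos zs y \<longleftrightarrow> pos ys x < pos ys y"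
    proof cases
      case 4
      have whole: "{1..<n} \<in> ?B \<and> x \<in> {1..<n} \<and> y \<in> {1..<n}" using 4 xy unfolding blocks_def by auto
      obtain M where M: "M \<in> ?B" "x \<in> M" "y \<in> M"
        and mn: "\<And>N. N \<in> ?B \<and> x \<in> N \<and> y \<in> N \<Longrightarrow> card M \<le> card N"
        using ex_has_least_nat[of "\<lambda>N. N \<in> ?B \<and> x \<in> N \<and> y \<in> N" _ card, OF whole] by blast
      have "M \<subseteq> N" if N: "N \<in> ?B" "x \<in> N" "y \<in> N" for N
      proof -
        consider "M \<subseteq> N" | "N \<subseteq> M"
          using blocks_props(2)[OF n ry Dy M(1) N(1)] M N unfolding laminar_def by blast
        then show ?thesis
        proof cases
          case 2
          have "finite M" using blocks_props(1)[OF n ry Dy M(1)] finite_subset by blast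
          then show ?thesis using card_seteq[of M N] 2 mn N by blast
        qed
      qed
      then have "sep ?B M x y" using M 4 unfolding sep_def by blast
      then show ?thesis using ag M by blast
    qed (use lt[OF rz xy(1)] lt[OF ry xy(1)] lt[OF rz xy(2)] lt[OF ry xy(2)] p0 in auto)
  qed
  then show ?thesis using tw ys by simp
qed

section \<open>Weights on chains and the embedding\<close>


lemma chain_support_least:
  fixes w :: "'s set \<Rightarrow> real" and h :: "'s set \<Rightarrow> 's \<Rightarrow> real"
  assumes fin: "finite F" and w0: "\<forall>D\<in>F. 0 \<le> w D"
    and chain: "\<forall>D\<in>F. \<forall>E\<in>F. w D \<noteq> 0 \<and> w E \<noteq> 0 \<longrightarrow> D \<subseteq> E \<or> E \<subseteq> D"
    and ex: "\<exists>D\<in>F. w D \<noteq> 0"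
    and h0: "\<forall>D\<in>F. \<forall>S. 0 \<le> h D S" and h_iff: "\<forall>D\<in>F. \<forall>S. h D S = 0 \<longleftrightarrow> S \<in> D"
  defines "L \<equiv> {S. (\<Sum>D\<in>F. w D * h D S) = 0}"
  shows "L \<in> F" "0 < w L" "\<And>D. D \<in> F \<Longrightarrow> w D \<noteq> 0 \<Longrightarrow> L \<subseteq> D"
proof -
  let ?P = "{D \<in> F. w D \<noteq> 0}"
  obtain M where M: "M \<in> ?P" "\<forall>D\<in>?P. D \<subseteq> M \<longrightarrow> M = D"
    using finite_has_minimal[of ?P] fin ex by auto
  have least: "M \<subseteq> D" if "D \<in> F" "w D \<noteq> 0" for D
    using M that chain by blast
  have "L = M"
  proof (intro set_eqI)
    fix S
    have "S \<in> L \<longleftrightarrow> (\<forall>D\<in>F. w D * h D S = 0)"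
      unfolding L_def using fin w0 h0 by (simp add: sum_nonneg_eq_0_iff)
    also have "\<dots> \<longleftrightarrow> (\<forall>D\<in>F. w D \<noteq> 0 \<longrightarrow> S \<in> D)" using h_iff by auto
    also have "\<dots> \<longleftrightarrow> S \<in> M" using M least by blast
    finally show "S \<in> L \<longleftrightarrow> S \<in> M" .
  qed
  then show "L \<in> F" "0 < w L" "\<And>D. D \<in> F \<Longrightarrow> w D \<noteq> 0 \<Longrightarrow> L \<subseteq> D"
    using M least w0 less_eq_real_def[of 0 "w M"] by auto
qed

text \<open>
  Subtracting the smaller of the two weights at the common least face shrinks one of the supports.
\<close>
lemma chain_weights_unique:
  fixes w w' :: "'s set \<Rightarrow> real" and h :: "'s set \<Rightarrow> 's \<Rightarrow> real"
  assumes fin: "finite F"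
    and h0: "\<forall>D\<in>F. \<forall>S. 0 \<le> h D S" and h_iff: "\<forall>D\<in>F. \<forall>S. h D S = 0 \<longleftrightarrow> S \<in> D"
    and "\<forall>D\<in>F. 0 \<le> w D" "\<forall>D\<in>F. \<forall>E\<in>F. w D \<noteq> 0 \<and> w E \<noteq> 0 \<longrightarrow> D \<subseteq> E \<or> E \<subseteq> D"
    and "\<forall>D\<in>F. 0 \<le> w' D" "\<forall>D\<in>F. \<forall>E\<in>F. w' D \<noteq> 0 \<and> w' E \<noteq> 0 \<longrightarrow> D \<subseteq> E \<or> E \<subseteq> D"
    and "sum w F = sum w' F" "\<forall>S. (\<Sum>D\<in>F. w D * h D S) = (\<Sum>D\<in>F. w' D * h D S)"
  shows "\<forall>D\<in>F. w D = w' D"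
  using assms(4-9)
proof (induction "card {D \<in> F. w D \<noteq> 0} + card {D \<in> F. w' D \<noteq> 0}" arbitrary: w w' rule: less_induct)
  case less
  have zero: "\<forall>D\<in>F. v D = 0" if "sum v F = 0" "\<forall>D\<in>F. 0 \<le> v D" for v :: "'s set \<Rightarrow> real"
    using that fin sum_nonneg_eq_0_iff[of F v] by simp
  show ?case
  proof (cases "(\<forall>D\<in>F. w D = 0) \<or> (\<forall>D\<in>F. w' D = 0)")
    case True
    then have "sum w F = 0" using less.prems(5) by auto
    then have "\<forall>D\<in>F. w D = 0" "\<forall>D\<in>F. w' D = 0"
      using zero[of w] zero[of w'] less.prems(1,3,5) by auto
    then show ?thesis by simp
  next
    case False
    define L where "L = {S. (\<Sum>D\<in>F. w D * h D S) = 0}"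
    have L': "L = {S. (\<Sum>D\<in>F. w' D * h D S) = 0}" unfolding L_def using less.prems(6) by simp
    have ex: "\<exists>D\<in>F. w D \<noteq> 0" "\<exists>D\<in>F. w' D \<noteq> 0" using False by auto
    have L: "L \<in> F" "0 < w L" "0 < w' L"
      using chain_support_least(1,2)[OF fin less.prems(1,2) ex(1) h0 h_iff, folded L_def]
        chain_support_least(2)[OF fin less.prems(3,4) ex(2) h0 h_iff, folded L'] by auto
    define t where "t = min (w L) (w' L)"
    define u where "u = w(L := w L - t)"
    define u' where "u' = w'(L := w' L - t)"
    have t: "0 < t" "t \<le> w L" "t \<le> w' L" "t = w L \<or> t = w' L" unfolding t_def using L by auto
    have shift: "(\<Sum>D\<in>F. (v(L := v L - t)) D * k D) = (\<Sum>D\<in>F. v D * k D) - t * k L" for v k :: "'s set \<Rightarrow> real"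
    proof -
      have "(\<Sum>D\<in>F. (v(L := v L - t)) D * k D) = (v L - t) * k L + (\<Sum>D\<in>F - {L}. v D * k D)"
        using fin L(1) by (simp add: sum.remove[of F L])
      also have "\<dots> = (\<Sum>D\<in>F. v D * k D) - t * k L"
        using fin L(1) by (simp add: sum.remove[of F L] algebra_simps)
      finally show ?thesis .
    qed
    have sup: "{D \<in> F. u D \<noteq> 0} \<subseteq> {D \<in> F. w D \<noteq> 0}" "{D \<in> F. u' D \<noteq> 0} \<subseteq> {D \<in> F. w' D \<noteq> 0}"
      unfolding u_def u'_def using L by (auto split: if_splits)
    have "L \<notin> {D \<in> F. u D \<noteq> 0} \<or> L \<notin> {D \<in> F. u' D \<noteq> 0}"
      unfolding u_def u'_def using t(4) by auto
    moreover have "L \<in> {D \<in> F. w D \<noteq> 0}" "L \<in> {D \<in> F. w' D \<noteq> 0}" using L by auto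
    ultimately have "{D \<in> F. u D \<noteq> 0} \<subset> {D \<in> F. w D \<noteq> 0} \<or> {D \<in> F. u' D \<noteq> 0} \<subset> {D \<in> F. w' D \<noteq> 0}"
      using sup by blast
    moreover have "finite {D \<in> F. w D \<noteq> 0}" "finite {D \<in> F. w' D \<noteq> 0}" using fin by auto
    ultimately have "card {D \<in> F. u D \<noteq> 0} + card {D \<in> F. u' D \<noteq> 0}
        < card {D \<in> F. w D \<noteq> 0} + card {D \<in> F. w' D \<noteq> 0}"
      using sup by (meson add_less_le_mono add_le_less_mono card_mono psubset_card_mono)
    moreover have "\<forall>D\<in>F. 0 \<le> u D" unfolding u_def using less.prems(1) t by auto
    moreover have "\<forall>D\<in>F. \<forall>E\<in>F. u D \<noteq> 0 \<and> u E \<noteq> 0 \<longrightarrow> D \<subseteq> E \<or> E \<subseteq> D"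
    proof (intro ballI impI)
      fix D E assume "D \<in> F" "E \<in> F" "u D \<noteq> 0 \<and> u E \<noteq> 0"
      then have "w D \<noteq> 0 \<and> w E \<noteq> 0" using sup(1) by blast
      then show "D \<subseteq> E \<or> E \<subseteq> D" using less.prems(2) \<open>D \<in> F\<close> \<open>E \<in> F\<close> by blast
    qed
    moreover have "\<forall>D\<in>F. 0 \<le> u' D" unfolding u'_def using less.prems(3) t by auto
    moreover have "\<forall>D\<in>F. \<forall>E\<in>F. u' D \<noteq> 0 \<and> u' E \<noteq> 0 \<longrightarrow> D \<subseteq> E \<or> E \<subseteq> D"
    proof (intro ballI impI)
      fix D E assume "D \<in> F" "E \<in> F" "u' D \<noteq> 0 \<and> u' E \<noteq> 0"
      then have "w' D \<noteq> 0 \<and> w' E \<noteq> 0" using sup(2) by blast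
      then show "D \<subseteq> E \<or> E \<subseteq> D" using less.prems(4) \<open>D \<in> F\<close> \<open>E \<in> F\<close> by blast
    qed
    moreover have "sum u F = sum u' F"
      using shift[of w "\<lambda>_. 1"] shift[of w' "\<lambda>_. 1"] less.prems(5) unfolding u_def u'_def by simp
    moreover have "\<forall>S. (\<Sum>D\<in>F. u D * h D S) = (\<Sum>D\<in>F. u' D * h D S)"
      using shift[of w "\<lambda>D. h D _"] shift[of w' "\<lambda>D. h D _"] less.prems(6) unfolding u_def u'_def by simp
    ultimately have u: "\<forall>D\<in>F. u D = u' D" by (rule less.hyps)
    show ?thesis
    proof
      fix D assume "D \<in> F"
      then have "u D = u' D" using u by blast
      then show "w D = w' D" unfolding u_def u'_def by (cases "D = L") auto
    qed
  qed
qed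

lemma Phi_face_eq_card:
  assumes pi: "\<pi> \<in> circ_orderings n"
  shows "Phi_face n \<pi> D S = real (card {T. triangulation n \<pi> T \<and> D \<subseteq> T \<and> S \<in> T}) /
    ((real n - 3) * real (card {T. triangulation n \<pi> T \<and> D \<subseteq> T}))"
proof -
  let ?N = "{T. triangulation n \<pi> T \<and> D \<subseteq> T}"
  have "finite ?N" using triangulation_finite[OF pi] .
  then have "(\<Sum>T\<in>?N. Phi_tri n T S) = (\<Sum>T\<in>?N \<inter> {T. S \<in> T}. 1 / (real n - 3))"
    unfolding Phi_tri_def using sum.inter_restrict[of ?N "\<lambda>_. 1 / (real n - 3)" "{T. S \<in> T}"] by simp
  also have "\<dots> = real (card (?N \<inter> {T. S \<in> T})) / (real n - 3)" by simp
  also have "?N \<inter> {T. S \<in> T} = {T. triangulation n \<pi> T \<and> D \<subseteq> T \<and> S \<in> T}" by auto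
  finally show ?thesis unfolding Phi_face_def by simp
qed

lemma Phi_face_bounds:
  assumes n: "4 \<le> n" and pi: "\<pi> \<in> circ_orderings n" and D: "noncrossing n \<pi> D"
  shows "0 \<le> Phi_face n \<pi> D S"
    and "(real n - 3) * Phi_face n \<pi> D S \<le> 1"
    and "(real n - 3) * Phi_face n \<pi> D S = 1 \<longleftrightarrow> S \<in> D"
    and "0 < Phi_face n \<pi> D S \<longleftrightarrow> noncrossing n \<pi> (insert S D)"
proof -
  let ?N = "{T. triangulation n \<pi> T \<and> D \<subseteq> T}" and ?C = "{T. triangulation n \<pi> T \<and> D \<subseteq> T \<and> S \<in> T}"
  have fin: "finite ?N" "finite ?C" using triangulation_finite[OF pi] by auto
  obtain T where "triangulation n \<pi> T" "D \<subseteq> T" using triangulation_extend[OF pi D] .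
  then have "?N \<noteq> {}" by blast
  then have N: "0 < card ?N" using fin by (simp add: card_gt_0_iff)
  have c: "0 < real n - 3" using n by simp
  have CN: "?C \<subseteq> ?N" by blast
  have eq: "(real n - 3) * Phi_face n \<pi> D S = real (card ?C) / real (card ?N)"
    unfolding Phi_face_eq_card[OF pi] using c by simp
  show "0 \<le> Phi_face n \<pi> D S" unfolding Phi_face_eq_card[OF pi] using c by simp
  show "(real n - 3) * Phi_face n \<pi> D S \<le> 1"
    unfolding eq using N card_mono[OF fin(1) CN] by simp
  have "(real n - 3) * Phi_face n \<pi> D S = 1 \<longleftrightarrow> card ?C = card ?N" unfolding eq using N by auto
  also have "\<dots> \<longleftrightarrow> ?C = ?N" using card_subset_eq[OF fin(1) CN] by auto
  also have "\<dots> \<longleftrightarrow> S \<in> D"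
  proof
    assume e: "?C = ?N"
    show "S \<in> D"
    proof (rule ccontr)
      assume "S \<notin> D"
      then obtain T where "triangulation n \<pi> T" "D \<subseteq> T" "S \<notin> T" using triangulation_avoiding[OF n pi D] by blast
      then show False using e by blast
    qed
  qed auto
  finally show "(real n - 3) * Phi_face n \<pi> D S = 1 \<longleftrightarrow> S \<in> D" .
  have "0 < Phi_face n \<pi> D S \<longleftrightarrow> 0 < card ?C"
    unfolding Phi_face_eq_card[OF pi] using c N by (simp add: zero_less_divide_iff)
  also have "\<dots> \<longleftrightarrow> ?C \<noteq> {}" using fin by (simp add: card_gt_0_iff)
  also have "\<dots> \<longleftrightarrow> noncrossing n \<pi> (insert S D)"
  proof
    assume "?C \<noteq> {}"
    then obtain T where "noncrossing n \<pi> T" "insert S D \<subseteq> T" unfolding triangulation_def by blast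
    then show "noncrossing n \<pi> (insert S D)" using noncrossing_subset[OF pi] by blast
  next
    assume "noncrossing n \<pi> (insert S D)"
    then obtain T where "triangulation n \<pi> T" "insert S D \<subseteq> T" using triangulation_extend[OF pi] by blast
    then show "?C \<noteq> {}" by blast
  qed
  finally show "0 < Phi_face n \<pi> D S \<longleftrightarrow> noncrossing n \<pi> (insert S D)" .
qed

lemma diags_nontrivial_circular:
  assumes lin: "lin_ord n ys" and S: "S \<in> diags n ys"
  shows "nontrivial_split n S" "circular_split n (circ_ord n ys) S"
proof -
  obtain i j where ij: "is_diag n i j" and Seq: "S = {(!) ys ` {i..<j}, {0..<n} - (!) ys ` {i..<j}}"
    using S lin by (rule diagsE)
  let ?A = "(!) ys ` {i..<j}"
  have d: "i < j" "j < n" "2 \<le> j - i" "j - i + 2 \<le> n" using ij unfolding is_diag_def by auto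
  have "inj_on ((!) ys) {i..<j}" using lin_ord_inj[OF lin] d by (auto intro: inj_on_subset)
  then have cA: "card ?A = j - i" by (simp add: card_image)
  have sub: "?A \<subseteq> {0..<n}" using lin_ord_image_subset[OF lin, of j i] d by simp
  have cB: "card ({0..<n} - ?A) = n - (j - i)"
    using card_Diff_subset[OF _ sub] cA by simp
  have "?A \<noteq> {}" using d by auto
  moreover have "?A \<noteq> {0..<n}" using cA d by force
  ultimately show "nontrivial_split n S"
    unfolding nontrivial_split_def is_split_def using sub cA cB d
    by (intro conjI exI[of _ ?A]) (simp_all add: Seq psubset_eq)
  have "twist_step n (circ_ord n ys) S (circ_ord n (rev_block i j ys))"
    unfolding Seq by (rule twist_step_rev_block[OF lin ij refl])
  then obtain us k where "us \<in> circ_ord n ys" "0 < k" "k < n" "S = {set (take k us), set (drop k us)}"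
    unfolding twist_step_def by metis
  then show "circular_split n (circ_ord n ys) S"
    unfolding circular_split_def by (intro bexI[of _ us] exI[of _ k]) simp_all
qed

lemma finite_nontrivial_splits: "finite {S. nontrivial_split n S}"
  by (rule finite_subset[of _ "Pow (Pow {0..<n})"]) (auto simp: nontrivial_split_def is_split_def)

lemma noncrossing_nontrivial_circular:
  assumes "\<pi> \<in> circ_orderings n" "noncrossing n \<pi> D" "S \<in> D"
  shows "nontrivial_split n S" "circular_split n \<pi> S"
proof -
  obtain ys where "ys \<in> \<pi>" using circ_orderings_nonempty assms by blast
  then have ys: "lin_ord n ys" "\<pi> = circ_ord n ys" using circ_orderingsE assms(1) by auto
  have "S \<in> diags n ys" using noncrossing_diags[OF ys(1)] assms(2,3) ys(2) by simp
  then show "nontrivial_split n S" "circular_split n \<pi> S"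
    using diags_nontrivial_circular[OF ys(1)] ys(2) by auto
qed

lemma sum_Phi_face:
  assumes n: "4 \<le> n" and pi: "\<pi> \<in> circ_orderings n" and D: "noncrossing n \<pi> D"
  shows "sum (Phi_face n \<pi> D) {S. nontrivial_split n S} = 1"
proof -
  let ?N = "{T. triangulation n \<pi> T \<and> D \<subseteq> T}" and ?X = "{S. nontrivial_split n S}"
  have fin: "finite ?N" using triangulation_finite[OF pi] .
  obtain T where "triangulation n \<pi> T" "D \<subseteq> T" using triangulation_extend[OF pi D] .
  then have "?N \<noteq> {}" by blast
  then have N: "0 < card ?N" using fin by (simp add: card_gt_0_iff)
  have one: "(\<Sum>S\<in>?X. Phi_tri n T S) = 1" if T: "T \<in> ?N" for T
  proof -
    have nc: "noncrossing n \<pi> T" using T unfolding triangulation_def by blast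
    have "?X \<inter> T = T" using noncrossing_nontrivial_circular(1)[OF pi nc] by blast
    then have "(\<Sum>S\<in>?X. Phi_tri n T S) = (\<Sum>S\<in>T. 1 / (real n - 3))"
      unfolding Phi_tri_def using finite_nontrivial_splits[of n]
      by (simp add: sum.inter_restrict[symmetric])
    also have "\<dots> = real (n - 3) / (real n - 3)" using triangulation_card[OF n pi] T by simp
    also have "\<dots> = 1" using n by (simp add: of_nat_diff)
    finally show ?thesis .
  qed
  have "sum (Phi_face n \<pi> D) ?X = (\<Sum>S\<in>?X. \<Sum>T\<in>?N. Phi_tri n T S) / real (card ?N)"
    unfolding Phi_face_def by (simp add: sum_divide_distrib)
  also have "(\<Sum>S\<in>?X. \<Sum>T\<in>?N. Phi_tri n T S) = (\<Sum>T\<in>?N. \<Sum>S\<in>?X. Phi_tri n T S)" by (rule sum.swap)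
  also have "\<dots> = real (card ?N)" using one by simp
  finally show ?thesis using N by simp
qed

lemma K_point_support: "K_point n \<pi> w \<Longrightarrow> w D \<noteq> 0 \<Longrightarrow> noncrossing n \<pi> D"
  by (simp add: K_point_def)

lemma Phi_pt_pos_iff:
  assumes n: "4 \<le> n" and pi: "\<pi> \<in> circ_orderings n" and K: "K_point n \<pi> w"
  shows "0 \<le> Phi_pt n \<pi> w S"
    and "0 < Phi_pt n \<pi> w S \<longleftrightarrow> (\<exists>D. w D \<noteq> 0 \<and> noncrossing n \<pi> (insert S D))"
proof -
  let ?F = "{D. noncrossing n \<pi> D}"
  have fin: "finite ?F" using finite_noncrossing[OF pi] .
  have w: "0 \<le> w D" "w D \<noteq> 0 \<Longrightarrow> noncrossing n \<pi> D" for D using K unfolding K_point_def by auto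
  have nn: "0 \<le> w D * Phi_face n \<pi> D S" if "D \<in> ?F" for D
    using that w Phi_face_bounds(1)[OF n pi] by simp
  show p: "0 \<le> Phi_pt n \<pi> w S" unfolding Phi_pt_def using nn by (rule sum_nonneg)
  have "Phi_pt n \<pi> w S = 0 \<longleftrightarrow> (\<forall>D\<in>?F. w D * Phi_face n \<pi> D S = 0)"
    unfolding Phi_pt_def using fin nn by (rule sum_nonneg_eq_0_iff)
  also have "\<dots> \<longleftrightarrow> \<not> (\<exists>D. w D \<noteq> 0 \<and> noncrossing n \<pi> (insert S D))"
    using w(2) Phi_face_bounds(1,4)[OF n pi] noncrossing_subset[OF pi]
    by (smt (verit) mem_Collect_eq mult_eq_0_iff)
  finally show "0 < Phi_pt n \<pi> w S \<longleftrightarrow> (\<exists>D. w D \<noteq> 0 \<and> noncrossing n \<pi> (insert S D))"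
    using p by (metis less_eq_real_def less_irrefl)
qed

lemma Phi_pt_in_chamber:
  assumes n: "4 \<le> n" and pi: "\<pi> \<in> circ_orderings n" and K: "K_point n \<pi> w"
  shows "Phi_pt n \<pi> w \<in> chamber n \<pi>"
proof -
  let ?F = "{D. noncrossing n \<pi> D}" and ?X = "{S. nontrivial_split n S}"
  have "nontrivial_split n S \<and> circular_split n \<pi> S" if "Phi_pt n \<pi> w S \<noteq> 0" for S
  proof -
    have "0 < Phi_pt n \<pi> w S" using Phi_pt_pos_iff(1)[OF n pi K, of S] that by simp
    then obtain D where "noncrossing n \<pi> (insert S D)" using Phi_pt_pos_iff(2)[OF n pi K] by blast
    then show ?thesis using noncrossing_nontrivial_circular[OF pi] by blast
  qed
  moreover have "sum (Phi_pt n \<pi> w) ?X = 1"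
  proof -
    have "sum (Phi_pt n \<pi> w) ?X = (\<Sum>D\<in>?F. \<Sum>S\<in>?X. w D * Phi_face n \<pi> D S)"
      unfolding Phi_pt_def by (rule sum.swap)
    also have "\<dots> = (\<Sum>D\<in>?F. w D * sum (Phi_face n \<pi> D) ?X)" by (simp add: sum_distrib_left)
    also have "\<dots> = sum w ?F" using sum_Phi_face[OF n pi] by simp
    finally show ?thesis using K unfolding K_point_def by simp
  qed
  ultimately show ?thesis unfolding chamber_def using Phi_pt_pos_iff(1)[OF n pi K] by blast
qed

lemma Phi_in_network_space:
  assumes "4 \<le> n" shows "Phi n ` Kspace n \<subseteq> network_space n"
  using Phi_pt_in_chamber[OF assms] unfolding Phi_def Kspace_def network_space_def by fastforce

lemma one_minus_Phi_pt:
  assumes K: "K_point n \<pi> w"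
  shows "1 - (real n - 3) * Phi_pt n \<pi> w S
    = (\<Sum>D\<in>{D. noncrossing n \<pi> D}. w D * (1 - (real n - 3) * Phi_face n \<pi> D S))"
proof -
  have "1 = (\<Sum>D\<in>{D. noncrossing n \<pi> D}. w D)" using K unfolding K_point_def by simp
  moreover have "(real n - 3) * Phi_pt n \<pi> w S
    = (\<Sum>D\<in>{D. noncrossing n \<pi> D}. w D * ((real n - 3) * Phi_face n \<pi> D S))"
    unfolding Phi_pt_def by (simp add: sum_distrib_left algebra_simps)
  ultimately show ?thesis by (simp add: sum_subtractf right_diff_distrib)
qed

lemma K_point_least:
  assumes n: "4 \<le> n" and pi: "\<pi> \<in> circ_orderings n" and K: "K_point n \<pi> w"
  defines "L \<equiv> {S. (real n - 3) * Phi_pt n \<pi> w S = 1}"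
  shows "noncrossing n \<pi> L" "0 < w L" "\<And>D. w D \<noteq> 0 \<Longrightarrow> L \<subseteq> D"
proof -
  let ?F = "{D. noncrossing n \<pi> D}" and ?h = "\<lambda>D S. 1 - (real n - 3) * Phi_face n \<pi> D S"
  have w: "0 \<le> w D" "w D \<noteq> 0 \<Longrightarrow> noncrossing n \<pi> D" "sum w ?F = 1"
    "w D \<noteq> 0 \<and> w E \<noteq> 0 \<Longrightarrow> D \<subseteq> E \<or> E \<subseteq> D" for D E
    using K unfolding K_point_def by blast+
  have ex: "\<exists>D\<in>?F. w D \<noteq> 0"
  proof (rule ccontr)
    assume "\<not> (\<exists>D\<in>?F. w D \<noteq> 0)"
    then have "sum w ?F = 0" by simp
    then show False using w(3) by simp
  qed
  have L: "L = {S. (\<Sum>D\<in>?F. w D * ?h D S) = 0}"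
    unfolding L_def one_minus_Phi_pt[OF K, symmetric] by auto
  have h: "\<forall>D\<in>?F. \<forall>S. 0 \<le> ?h D S" "\<forall>D\<in>?F. \<forall>S. ?h D S = 0 \<longleftrightarrow> S \<in> D"
    using Phi_face_bounds(2,3)[OF n pi] by auto
  have w': "\<forall>D\<in>?F. 0 \<le> w D" "\<forall>D\<in>?F. \<forall>E\<in>?F. w D \<noteq> 0 \<and> w E \<noteq> 0 \<longrightarrow> D \<subseteq> E \<or> E \<subseteq> D"
    using w(1,4) by blast+
  note cs = chain_support_least[OF finite_noncrossing[OF pi] w' ex h, folded L]
  show "noncrossing n \<pi> L" "0 < w L" using cs(1,2) by auto
  show "L \<subseteq> D" if "w D \<noteq> 0" for D using cs(3) w(2)[OF that] that by simp
qed

lemma Phi_pt_inj: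
  assumes n: "4 \<le> n" and pi: "\<pi> \<in> circ_orderings n" and K: "K_point n \<pi> w" and K': "K_point n \<pi> w'"
    and eq: "Phi_pt n \<pi> w = Phi_pt n \<pi> w'"
  shows "w = w'"
proof -
  let ?F = "{D. noncrossing n \<pi> D}" and ?h = "\<lambda>D S. 1 - (real n - 3) * Phi_face n \<pi> D S"
  have "\<forall>D\<in>?F. w D = w' D"
  proof (rule chain_weights_unique[of ?F ?h])
    show "finite ?F" using finite_noncrossing[OF pi] .
    show "\<forall>D\<in>?F. \<forall>S. 0 \<le> ?h D S" "\<forall>D\<in>?F. \<forall>S. ?h D S = 0 \<longleftrightarrow> S \<in> D"
      using Phi_face_bounds(2,3)[OF n pi] by auto
    show "\<forall>S. (\<Sum>D\<in>?F. w D * ?h D S) = (\<Sum>D\<in>?F. w' D * ?h D S)"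
      unfolding one_minus_Phi_pt[OF K, symmetric] one_minus_Phi_pt[OF K', symmetric] eq by simp
  qed (use K K' in \<open>simp_all add: K_point_def\<close>)
  moreover have "w D = 0 \<and> w' D = 0" if "\<not> noncrossing n \<pi> D" for D
    using that K_point_support[OF K, of D] K_point_support[OF K', of D] by argo
  ultimately have "w D = w' D" for D by (cases "noncrossing n \<pi> D") auto
  then show ?thesis by blast
qed

lemma Phi_eq_imp_ident:
  assumes n: "4 \<le> n" and p: "p \<in> Kspace n" and q: "q \<in> Kspace n" and eq: "Phi n p = Phi n q"
  shows "ident n p q"
proof -
  obtain \<pi> w \<pi>' w' where pq: "p = (\<pi>, w)" "q = (\<pi>', w')" by fastforce
  have K: "\<pi> \<in> circ_orderings n" "K_point n \<pi> w" "\<pi>' \<in> circ_orderings n" "K_point n \<pi>' w'"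
    using p q pq unfolding Kspace_def by auto
  have e: "Phi_pt n \<pi> w = Phi_pt n \<pi>' w'" using eq pq unfolding Phi_def by simp
  define L where "L = {S. (real n - 3) * Phi_pt n \<pi> w S = 1}"
  have L: "noncrossing n \<pi> L" "0 < w L" "\<And>D. w D \<noteq> 0 \<Longrightarrow> L \<subseteq> D"
    using K_point_least[OF n K(1,2)] unfolding L_def by auto
  have L': "noncrossing n \<pi>' L" "0 < w' L" "\<And>D. w' D \<noteq> 0 \<Longrightarrow> L \<subseteq> D"
    using K_point_least[OF n K(3,4)] unfolding L_def e by auto
  have tw: "twists n L \<pi> \<pi>'"
  proof (rule twists_connected[OF n K(1,3) L(1) L'(1)])
    fix S assume "noncrossing n \<pi> (insert S L)"
    then have "0 < Phi_pt n \<pi> w S" using Phi_pt_pos_iff(2)[OF n K(1,2)] L(2) by force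
    then obtain D where D: "w' D \<noteq> 0" "noncrossing n \<pi>' (insert S D)"
      unfolding e using Phi_pt_pos_iff(2)[OF n K(3,4)] by blast
    then show "noncrossing n \<pi>' (insert S L)"
      using noncrossing_subset[OF K(3) D(2), of "insert S L"] L'(3)[OF D(1)] by blast
  qed
  have same: "noncrossing n \<pi> D \<longleftrightarrow> noncrossing n \<pi>' D" if "L \<subseteq> D" for D
    using twists_noncrossing[OF tw K(1) L(1)] that by blast
  have Kw: "K_point n \<pi>' w"
  proof -
    have w: "\<And>D. w D \<noteq> 0 \<Longrightarrow> noncrossing n \<pi> D" using K(2) unfolding K_point_def by blast
    have w': "\<And>D. w D \<noteq> 0 \<Longrightarrow> noncrossing n \<pi>' D" using w same L(3) by blast
    have "sum w {D. noncrossing n \<pi>' D} = sum w {D. w D \<noteq> 0}"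
      using w' finite_noncrossing[OF K(3)] by (intro sum.mono_neutral_right) auto
    also have "\<dots> = sum w {D. noncrossing n \<pi> D}"
      using w finite_noncrossing[OF K(1)] by (intro sum.mono_neutral_left) auto
    finally show ?thesis using K(2) w' unfolding K_point_def by simp
  qed
  have id: "ident n p (\<pi>', w)"
    unfolding ident_def using p K(3) Kw L tw pq unfolding Kspace_def by auto
  then have "Phi_pt n \<pi>' w = Phi_pt n \<pi>' w'"
    using ident_imp_Phi_eq[OF id] e unfolding pq Phi_def by simp
  then have "w = w'" using Phi_pt_inj[OF n K(3) Kw K(4)] by simp
  then show ?thesis using id pq by simp
qed

lemma equivclp_ident_imp_Phi_eq: "equivclp (ident n) x y \<Longrightarrow> Phi n x = Phi n y"
proof (induction rule: equivclp_induct)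
  case (step y z)
  then show ?case using ident_imp_Phi_eq[of n y z] ident_imp_Phi_eq[of n z y] by auto
qed simp

lemma finite_circ_orderings: "finite (circ_orderings n)"
proof -
  have "finite {ys. lin_ord n ys}"
    by (rule finite_subset[OF _ finite_subset_distinct[of "{0..<n}"]]) (auto simp: lin_ord_def)
  then show ?thesis unfolding circ_orderings_def by simp
qed

lemma compactin_K_points:
  assumes pi: "\<pi> \<in> circ_orderings n"
  shows "compactin (powertop_real UNIV) {w. K_point n \<pi> w}"
proof (rule closed_compactin)
  let ?F = "{D. noncrossing n \<pi> D}"
  show "compactin (powertop_real UNIV) (PiE UNIV (\<lambda>_. {0..1::real}))"
    by (simp add: compactin_PiE)
  show "{w. K_point n \<pi> w} \<subseteq> PiE UNIV (\<lambda>_. {0..1})"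
  proof
    fix w assume "w \<in> {w. K_point n \<pi> w}"
    then have K: "\<And>D. 0 \<le> w D" "\<And>D. w D \<noteq> 0 \<Longrightarrow> D \<in> ?F" "sum w ?F = 1"
      unfolding K_point_def by auto
    have "w D \<le> 1" for D
    proof (cases "D \<in> ?F")
      case True
      then show ?thesis using member_le_sum[of D ?F w] K finite_noncrossing[OF pi] by auto
    next
      case False
      then show ?thesis using K(2)[of D] by fastforce
    qed
    then show "w \<in> PiE UNIV (\<lambda>_. {0..1})" using K(1) by auto
  qed
  have co: "continuous_on UNIV (\<lambda>w :: nat set set set \<Rightarrow> real. w D)" for D by simp
  have supp: "(\<forall>D. w D \<noteq> 0 \<longrightarrow> N D) \<longleftrightarrow> (\<forall>D. \<not> N D \<longrightarrow> w D = 0)"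
    for w :: "nat set set set \<Rightarrow> real" and N by metis
  have chain: "(\<forall>D E. w D \<noteq> 0 \<and> w E \<noteq> 0 \<longrightarrow> C D E) \<longleftrightarrow> (\<forall>D E. \<not> C D E \<longrightarrow> w D * w E = 0)"
    for w :: "nat set set set \<Rightarrow> real" and C by (metis mult_eq_0_iff)
  have "{w. K_point n \<pi> w} = {w. \<forall>D. 0 \<le> w D} \<inter> {w. \<forall>D. \<not> noncrossing n \<pi> D \<longrightarrow> w D = 0} \<inter>
      {w. sum w ?F = 1} \<inter> {w. \<forall>D E. \<not> (D \<subseteq> E \<or> E \<subseteq> D) \<longrightarrow> w D * w E = 0}"
    by (simp only: K_point_def supp chain[of _ "\<lambda>D E. D \<subseteq> E \<or> E \<subseteq> D"] Collect_conj_eq Int_assoc)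
  moreover have "closed {w :: nat set set set \<Rightarrow> real. \<forall>D. 0 \<le> w D}"
    by (intro closed_Collect_all closed_Collect_le continuous_intros co)
  moreover have "closed {w :: nat set set set \<Rightarrow> real. \<forall>D. \<not> noncrossing n \<pi> D \<longrightarrow> w D = 0}"
    by (intro closed_Collect_all closed_Collect_imp open_Collect_const closed_Collect_eq continuous_intros co)
  moreover have "closed {w :: nat set set set \<Rightarrow> real. sum w ?F = 1}"
    by (intro closed_Collect_eq continuous_intros co)
  moreover have "closed {w :: nat set set set \<Rightarrow> real. \<forall>D E. \<not> (D \<subseteq> E \<or> E \<subseteq> D) \<longrightarrow> w D * w E = 0}"
    by (intro closed_Collect_all closed_Collect_imp open_Collect_const closed_Collect_eq continuous_intros co)
  ultimately have "closed {w. K_point n \<pi> w}" by (simp only: closed_Int)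
  then show "closedin (powertop_real UNIV) {w. K_point n \<pi> w}"
    unfolding euclidean_product_topology closed_closedin .
qed

lemma topspace_Ktop: "topspace (Ktop n) = Kspace n"
  unfolding Ktop_def Kspace_def by auto

lemma compact_Ktop: "compact_space (Ktop n)"
proof -
  have "Kspace n = (\<Union>\<pi>\<in>circ_orderings n. {\<pi>} \<times> {w. K_point n \<pi> w})" unfolding Kspace_def by auto
  also have "compactin (prod_topology (discrete_topology (circ_orderings n)) (powertop_real UNIV)) \<dots>"
    using finite_circ_orderings compactin_K_points
    by (intro compactin_Union) (auto simp: compactin_Times)
  finally show ?thesis unfolding Ktop_def by (rule compact_space_subtopology)
qed

lemma continuous_map_Phi: "continuous_map (Ktop n) (powertop_real UNIV) (Phi n)"
proof -
  let ?P = "prod_topology (discrete_topology (circ_orderings n)) (powertop_real (UNIV :: nat set set set set))"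
  have "continuous_map (Ktop n) euclideanreal (\<lambda>p. Phi n p S)" for S
  proof (rule continuous_map_eq)
    let ?g = "\<lambda>p. \<Sum>\<pi>\<in>circ_orderings n. (if fst p = \<pi> then 1 else 0) *
      (\<Sum>D\<in>{D. noncrossing n \<pi> D}. snd p D * Phi_face n \<pi> D S)"
    have ind: "continuous_map ?P euclideanreal (\<lambda>p. if fst p = \<pi> then 1 else 0)" for \<pi>
    proof -
      have "continuous_map (discrete_topology (circ_orderings n)) euclideanreal (\<lambda>x. if x = \<pi> then 1 else 0)"
        by simp
      from continuous_map_compose[OF continuous_map_fst this] show ?thesis by (simp add: o_def)
    qed
    have co: "continuous_map ?P euclideanreal (\<lambda>p. snd p D)" for D
      using continuous_map_compose[OF continuous_map_snd continuous_map_product_projection[of D UNIV "\<lambda>_. euclideanreal"]]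
      by (simp add: o_def)
    have "continuous_map ?P euclideanreal ?g"
      using finite_circ_orderings finite_noncrossing
      by (intro continuous_map_sum continuous_map_real_mult ind continuous_map_real_mult_right co) auto
    then show "continuous_map (Ktop n) euclideanreal ?g"
      unfolding Ktop_def by (rule continuous_map_from_subtopology)
    fix p assume "p \<in> topspace (Ktop n)"
    then have "fst p \<in> circ_orderings n" unfolding topspace_Ktop Kspace_def by auto
    then show "?g p = Phi n p S" unfolding Phi_def Phi_pt_def
      using finite_circ_orderings by (simp add: if_distrib[of "\<lambda>x. x * _"] cong: if_cong)
  qed
  then show ?thesis by (simp add: continuous_map_componentwise_UNIV)
qed

theorem theorem12:
  fixes n :: nat
  assumes "4 \<le> n"
  shows "(\<forall>p q. ident n p q \<longrightarrow> Phi n p = Phi n q) \<and>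
         Phi n ` Kspace n \<subseteq> network_space n \<and>
         (\<forall>(Y :: 'm topology) q. quotient_map (Ktop n) Y q \<and>
             (\<forall>x\<in>Kspace n. \<forall>y\<in>Kspace n. q x = q y \<longleftrightarrow> equivclp (ident n) x y)
           \<longrightarrow> (\<exists>g. embedding_map Y (subtopology (powertop_real UNIV) (network_space n)) g \<and>
                    (\<forall>x\<in>Kspace n. g (q x) = Phi n x)))"
proof (intro conjI allI impI)
  show "Phi n p = Phi n q" if "ident n p q" for p q using ident_imp_Phi_eq[OF that] .
  show im: "Phi n ` Kspace n \<subseteq> network_space n" using Phi_in_network_space[OF assms] .
  fix Y :: "'m topology" and q
  assume "quotient_map (Ktop n) Y q \<and>
    (\<forall>x\<in>Kspace n. \<forall>y\<in>Kspace n. q x = q y \<longleftrightarrow> equivclp (ident n) x y)"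
  then have q: "quotient_map (Ktop n) Y q"
    and eqv: "\<And>x y. x \<in> Kspace n \<Longrightarrow> y \<in> Kspace n \<Longrightarrow> q x = q y \<longleftrightarrow> equivclp (ident n) x y"
    by blast+
  let ?Z = "subtopology (powertop_real UNIV) (network_space n)"
  have cont: "continuous_map (Ktop n) ?Z (Phi n)"
    using continuous_map_Phi im topspace_Ktop by (auto simp: continuous_map_in_subtopology)
  have lift: "Phi n x = Phi n y" if "x \<in> topspace (Ktop n)" "y \<in> topspace (Ktop n)" "q x = q y" for x y
    using that eqv equivclp_ident_imp_Phi_eq unfolding topspace_Ktop by blast
  obtain g where g: "continuous_map Y ?Z g" "\<And>x. x \<in> Kspace n \<Longrightarrow> g (q x) = Phi n x"
  proof (rule quotient_map_lift_exists[OF q cont])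
    fix g assume "continuous_map Y ?Z g" "\<And>x. x \<in> topspace (Ktop n) \<Longrightarrow> g (q x) = Phi n x"
    then show thesis by (intro that) (simp_all add: topspace_Ktop)
  qed (rule lift)
  have sY: "topspace Y = q ` Kspace n" using quotient_imp_surjective_map[OF q] by (simp add: topspace_Ktop)
  have "inj_on g (topspace Y)"
    unfolding sY
  proof (rule inj_onI)
    fix a b assume "a \<in> q ` Kspace n" "b \<in> q ` Kspace n" and gab: "g a = g b"
    then obtain x y where xy: "x \<in> Kspace n" "y \<in> Kspace n" "a = q x" "b = q y" by blast
    then have "ident n x y" using Phi_eq_imp_ident[OF assms] g(2) gab by simp
    then show "a = b" using eqv xy by (simp add: r_into_equivclp)
  qed
  moreover have "compact_space Y"
  proof -
    have "compactin (Ktop n) (Kspace n)" using compact_Ktop topspace_Ktop unfolding compact_space_def by metis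
    then show ?thesis unfolding compact_space_def sY
      by (rule image_compactin[OF _ quotient_imp_continuous_map[OF q]])
  qed
  moreover have "Hausdorff_space ?Z"
    by (intro Hausdorff_space_subtopology) (simp add: Hausdorff_space_product_topology)
  ultimately have "embedding_map Y ?Z g"
    using g(1) by (intro injective_closed_imp_embedding_map T1_Spaces.continuous_imp_closed_map) auto
  then show "\<exists>g. embedding_map Y ?Z g \<and> (\<forall>x\<in>Kspace n. g (q x) = Phi n x)" using g(2) by blast
qed

end
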